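(* Let $\alpha\in(0,1)$. Let $A,B$ be the fixed smooth coefficients, and let $f_N$, $s_N$ ($N\ge 1$) be the functions, defined in the context; $f_N$ is a smooth stationary ($t$-independent) solution of $$\partial_t f+\frac{p}{\langle p\rangle}\cdot\nabla_x f=\operatorname{tr}\bigl(A(p)D_p^2f\bigr)+B(p)\cdot\nabla_p f+s\qquad(\ast)$$ with these $A,B$ and with $s=s_N$. There are constants $c,C>0$ and $N_0\ge 1$ such that, for every $N\ge N_0$, the smooth stationary solution $f_N$ satisfies on $\mathcal Q_1=(-1,0]\times B_1^x\times B_1^p$ the bounds $$\|f_N\|_{L^\infty(\mathcal Q_1)}\le C N^{-2/3},\qquad [s_N]_{C_p^\alpha(\mathcal Q_1)}=0,$$ and $$[D_p^2 f_N]_{C_p^\alpha(\mathcal Q_{1/2})}\ge c\,N^{\alpha/3}.$$ Consequently, for the fixed smooth coefficients $A,B$, no estimate of the form $$[D_p^2f]_{C_p^\alpha(\mathcal Q_{1/2})}\le C_{A,B,\alpha}\Bigl(\|f\|_{L^\infty(\mathcal Q_1)}+[s]_{C_p^\alpha(\mathcal Q_1)}\Bigr)$$ can hold for all smooth solutions of $(\ast)$. More generally, the family rules out any proposed local Schauder estimate whose right-hand side involves only quantities that remain uniformly bounded along it; this includes momentum H\"older norms of the coefficients and forcing of any order, with no spatial modulus. This is made precise as follows: for $\alpha,\beta\in(0,1)$ there is no function $\mathcal F:[0,\infty)^4\to[0,\infty)$ that is bounded on bounded subsets and for which $$[D_p^2f]_{C_p^\alpha(\mathcal Q_{1/2})}\le\mathcal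 F\Bigl(\|f\|_{L^\infty(\mathcal Q_1)},\ \|s\|_{C_p^\beta(\mathcal Q_1)},\ \|A\|_{C_p^\beta(B_1)},\ \|B\|_{C_p^\beta(B_1)}\Bigr)$$ holds for every smooth solution of $(\ast)$ on $\mathcal Q_1$ (here with general coefficients $A(p),B(p)$), even within a fixed uniformly elliptic class.
   Context: Variables: $(t,x,p)\in\mathbb R\times\mathbb R^3\times\mathbb R^3$; $\langle p\rangle=(1+|p|^2)^{1/2}$; $\Phi(p)=p/\langle p\rangle$, a map from $\mathbb R^3$ onto the open unit ball. Cylinders: for $r>0$, $\mathcal Q_r=(-r^2,0]\times B_{r^3}^x\times B_r^p$, where $B^x_\rho,B^p_\rho$ are the balls of radius $\rho$ centered at $0$ in the $x$ and $p$ variables; $B_1$ in the coefficient norms is the unit momentum ball. Momentum H\"older seminorm: for $h=h(t,x,p)$ on a product cylinder $Q$, $$[h]_{C_p^\alpha(Q)}=\sup_{\substack{(t,x,p),(t,x,p')\in Q\\0<|p-p'|<1/2}}\frac{|h(t,x,p)-h(t,x,p')|}{|p-p'|^\alpha},$$ and $\|h\|_{C_p^\beta(Q)}=\|h\|_{L^\infty(Q)}+[h]_{C_p^\beta(Q)}$. For functions of $p$ alone, such as coefficients, the same seminorm is used on a momentum ball. For matrix-valued functions the Frobenius norm is used. $D_p^2 f$ is the Hessian in $p$. Fixed coefficients: $$A(p)=\langle p\rangle^2(\mathrm{Id}+p\otimes p)^2,\qquad B(p)=\bigl(3\langle p\rangle^4+2\langle p\rangle^2\bigr)p.$$ Functions: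 for $N\ge1$ and $\eta\in\mathbb R$, $$I_N(\eta)=\int_0^\infty \exp\!\left(-\frac{N^2s^3}{3}\right)e^{-\mathrm i N s\eta}\,ds,$$ $$u_N(x,v)=\operatorname{Re}\bigl(e^{\mathrm i N x_1}I_N(v_1)\bigr),\qquad f_N(x,p)=u_N(x,\Phi(p)),\qquad s_N(x)=\cos(Nx_1),$$ where $x_1,v_1$ denote first coordinates; $f_N$ and $s_N$ are regarded as functions of $(t,x,p)$. *)

theory Defs
  imports "HOL-Analysis.Analysis" "HOL-Probability.Essential_Supremum"
begin

type_synonym vec3 = "real ^ 3"
type_synonym mat3 = "real ^ 3 ^ 3"

text \<open>Points of the phase space are triples \<open>(t, x, p)\<close>.\<close>
type_synonym phase = "real \<times> vec3 \<times> vec3"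

definition gradient :: "(real ^ 'n \<Rightarrow> real) \<Rightarrow> real ^ 'n \<Rightarrow> real ^ 'n" where
  "gradient g x = (\<chi> i. frechet_derivative g (at x) (axis i 1))"

definition hessian :: "(real ^ 'n \<Rightarrow> real) \<Rightarrow> real ^ 'n \<Rightarrow> real ^ 'n ^ 'n" where
  "hessian g x = jacobian (gradient g) (at x)"

text \<open>Intended for open \<open>U\<close> in a finite-dimensional space, where continuity of all directional
  derivatives up to order \<open>k\<close> is the usual notion of \<open>C\<^sup>k\<close>.\<close>
fun Ck_on :: "nat \<Rightarrow> 'a::euclidean_space set \<Rightarrow> ('a \<Rightarrow> 'b::real_normed_vector) \<Rightarrow> bool" where
  "Ck_on 0 U f \<longleftrightarrow> continuous_on U f"
| "Ck_on (Suc k) U f \<longleftrightarrow>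
     (\<forall>z\<in>U. f differentiable (at z)) \<and> (\<forall>v. Ck_on k U (\<lambda>z. frechet_derivative f (at z) v))"

text \<open>The cylinders are half-open in time; on a set that is not open, smooth means being the
  restriction of a smooth function on an open neighbourhood.\<close>
definition smooth_on :: "'a::euclidean_space set \<Rightarrow> ('a \<Rightarrow> 'b::real_normed_vector) \<Rightarrow> bool" where
  "smooth_on S f \<longleftrightarrow>
     (\<exists>U g. open U \<and> S \<subseteq> U \<and> (\<forall>k. Ck_on k U g) \<and> (\<forall>z\<in>S. f z = g z))"

definition cyl :: "real \<Rightarrow> phase set" where
  "cyl r = {- (r ^ 2)<..0} \<times> ball 0 (r ^ 3) \<times> ball 0 r"

text \<open>Norms and seminorms take values in \<open>[0, \<infinity>]\<close>, since a function that is smooth on a cylinder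
  may be unbounded there. The library norm on \<open>mat3\<close> is the Frobenius norm.\<close>

definition Linf_norm :: "'a::euclidean_space set \<Rightarrow> ('a \<Rightarrow> 'b::real_normed_vector) \<Rightarrow> ennreal" where
  "Linf_norm S h = esssup (lebesgue_on S) (\<lambda>z. ennreal (norm (h z)))"

definition holder_semi :: "real \<Rightarrow> phase set \<Rightarrow> (phase \<Rightarrow> 'b::real_normed_vector) \<Rightarrow> ennreal" where
  "holder_semi \<alpha> Q h =
     Sup {ennreal (norm (h (t, x, p) - h (t, x, p')) / norm (p - p') powr \<alpha>) | t x p p'.
            (t, x, p) \<in> Q \<and> (t, x, p') \<in> Q \<and> 0 < norm (p - p') \<and> norm (p - p') < 1 / 2}"

definition holder_norm :: "real \<Rightarrow> phase set \<Rightarrow> (phase \<Rightarrow> 'b::real_normed_vector) \<Rightarrow> ennreal" where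
  "holder_norm \<beta> Q h = Linf_norm Q h + holder_semi \<beta> Q h"

definition holder_semi_mom :: "real \<Rightarrow> vec3 set \<Rightarrow> (vec3 \<Rightarrow> 'b::real_normed_vector) \<Rightarrow> ennreal" where
  "holder_semi_mom \<alpha> P h =
     Sup {ennreal (norm (h p - h p') / norm (p - p') powr \<alpha>) | p p'.
            p \<in> P \<and> p' \<in> P \<and> 0 < norm (p - p') \<and> norm (p - p') < 1 / 2}"

definition holder_norm_mom :: "real \<Rightarrow> vec3 set \<Rightarrow> (vec3 \<Rightarrow> 'b::real_normed_vector) \<Rightarrow> ennreal" where
  "holder_norm_mom \<beta> P h = Linf_norm P h + holder_semi_mom \<beta> P h"

definition japanese :: "vec3 \<Rightarrow> real" where
  "japanese p = sqrt (1 + (norm p)\<^sup>2)"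

definition \<Phi> :: "vec3 \<Rightarrow> vec3" where
  "\<Phi> p = p /\<^sub>R japanese p"

definition hess_p :: "(phase \<Rightarrow> real) \<Rightarrow> phase \<Rightarrow> mat3" where
  "hess_p f = (\<lambda>(t, x, p). hessian (\<lambda>q. f (t, x, q)) p)"

text \<open>The time derivative is taken within \<open>D\<close>, hence is one-sided at the final time of a cylinder.\<close>
definition solves_on ::
  "phase set \<Rightarrow> (vec3 \<Rightarrow> mat3) \<Rightarrow> (vec3 \<Rightarrow> vec3) \<Rightarrow> (phase \<Rightarrow> real) \<Rightarrow> (phase \<Rightarrow> real) \<Rightarrow> bool" where
  "solves_on D A B f s \<longleftrightarrow>
     (\<forall>(t, x, p)\<in>D.
        vector_derivative (\<lambda>\<tau>. f (\<tau>, x, p)) (at t within {\<tau>. (\<tau>, x, p) \<in> D})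
          + \<Phi> p \<bullet> gradient (\<lambda>y. f (t, y, p)) x
        = trace (A p ** hess_p f (t, x, p))
          + B p \<bullet> gradient (\<lambda>q. f (t, x, q)) p + s (t, x, p))"

definition outer :: "vec3 \<Rightarrow> vec3 \<Rightarrow> mat3" where
  "outer p q = (\<chi> i j. p $ i * q $ j)"

definition A\<^sub>0 :: "vec3 \<Rightarrow> mat3" where
  "A\<^sub>0 p = (japanese p)\<^sup>2 *\<^sub>R ((mat 1 + outer p p) ** (mat 1 + outer p p))"

definition B\<^sub>0 :: "vec3 \<Rightarrow> vec3" where
  "B\<^sub>0 p = (3 * japanese p ^ 4 + 2 * (japanese p)\<^sup>2) *\<^sub>R p"

definition I\<^sub>N :: "real \<Rightarrow> real \<Rightarrow> complex" where
  "I\<^sub>N N \<eta> = (LINT s:{0..}|lborel.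
      complex_of_real (exp (- (N\<^sup>2 * s ^ 3 / 3))) * exp (- (\<i> * complex_of_real (N * s * \<eta>))))"

definition u\<^sub>N :: "real \<Rightarrow> vec3 \<Rightarrow> vec3 \<Rightarrow> real" where
  "u\<^sub>N N x v = Re (exp (\<i> * complex_of_real (N * x $ 1)) * I\<^sub>N N (v $ 1))"

definition f\<^sub>N :: "real \<Rightarrow> phase \<Rightarrow> real" where
  "f\<^sub>N N = (\<lambda>(t, x, p). u\<^sub>N N x (\<Phi> p))"

definition s\<^sub>N :: "real \<Rightarrow> phase \<Rightarrow> real" where
  "s\<^sub>N N = (\<lambda>(t, x, p). cos (N * x $ 1))"

definition linear_schauder ::
  "(vec3 \<Rightarrow> mat3) \<Rightarrow> (vec3 \<Rightarrow> vec3) \<Rightarrow> real \<Rightarrow> real \<Rightarrow> bool" where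
  "linear_schauder A B \<alpha> C \<longleftrightarrow>
     (\<forall>f s. smooth_on (cyl 1) f \<and> solves_on (cyl 1) A B f s \<longrightarrow>
        holder_semi \<alpha> (cyl (1 / 2)) (hess_p f)
          \<le> ennreal C * (Linf_norm (cyl 1) f + holder_semi \<alpha> (cyl 1) s))"

definition elliptic_class :: "real \<Rightarrow> real \<Rightarrow> ((vec3 \<Rightarrow> mat3) \<times> (vec3 \<Rightarrow> vec3)) set" where
  "elliptic_class l L =
     {(A, B). \<forall>p\<in>ball 0 1. transpose (A p) = A p \<and>
        (\<forall>\<xi>. l * (norm \<xi>)\<^sup>2 \<le> \<xi> \<bullet> (A p *v \<xi>) \<and> \<xi> \<bullet> (A p *v \<xi>) \<le> L * (norm \<xi>)\<^sup>2)}"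

definition orthant :: "(real \<times> real \<times> real \<times> real) set" where
  "orthant = {0..} \<times> {0..} \<times> {0..} \<times> {0..}"

definition bounded_on_bounded :: "(real \<times> real \<times> real \<times> real \<Rightarrow> real) \<Rightarrow> bool" where
  "bounded_on_bounded F \<longleftrightarrow>
     F ` orthant \<subseteq> {0..} \<and> (\<forall>S. S \<subseteq> orthant \<and> bounded S \<longrightarrow> bounded (F ` S))"

text \<open>\<open>F\<close> takes finite arguments only, so the estimate is asserted when all four norms are finite.\<close>
definition general_schauder ::
  "((vec3 \<Rightarrow> mat3) \<times> (vec3 \<Rightarrow> vec3)) set \<Rightarrow> real \<Rightarrow> real
     \<Rightarrow> (real \<times> real \<times> real \<times> real \<Rightarrow> real) \<Rightarrow> bool" where
  "general_schauder K \<alpha> \<beta> F \<longleftrightarrow>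
     (\<forall>A B f s. (A, B) \<in> K \<and> smooth_on (cyl 1) f \<and> solves_on (cyl 1) A B f s \<and>
        Linf_norm (cyl 1) f < \<infinity> \<and> holder_norm \<beta> (cyl 1) s < \<infinity> \<and>
        holder_norm_mom \<beta> (ball 0 1) A < \<infinity> \<and> holder_norm_mom \<beta> (ball 0 1) B < \<infinity> \<longrightarrow>
        holder_semi \<alpha> (cyl (1 / 2)) (hess_p f)
          \<le> ennreal (F (enn2real (Linf_norm (cyl 1) f),
                        enn2real (holder_norm \<beta> (cyl 1) s),
                        enn2real (holder_norm_mom \<beta> (ball 0 1) A),
                        enn2real (holder_norm_mom \<beta> (ball 0 1) B))))"

end

theory Submission
  imports Defs "HOL-Probability.Characteristic_Functions" "HOL-Real_Asymp.Real_Asymp"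
begin

text \<open>
  In the velocity \<open>v = \<Phi> p\<close> the diffusion becomes the standard Laplacian. The matrix \<open>A\<^sub>0\<close> is the square of the
  inverse of the symmetric matrix \<open>D\<Phi>\<close>, and \<open>B\<^sub>0\<close> cancels the first-order term that the change of
  variables produces, so for \<open>f(x, p) = u(x, \<Phi> p)\<close> the right-hand operator is the Laplacian of \<open>u\<close> in
  \<open>v\<close>. For \<open>u\<close> depending on \<open>x\<^sub>1\<close> and \<open>v\<^sub>1\<close> only, the stationary problem with forcing \<open>cos (N x\<^sub>1)\<close> is
  \<open>v\<^sub>1 \<partial>\<^sub>1 u = \<partial>\<^sup>2 u / \<partial>v\<^sub>1\<^sup>2 + cos (N x\<^sub>1)\<close>. Separating the factor \<open>e\<^sup>i\<^sup>N\<^sup>x\<close> leaves the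
  inhomogeneous Airy equation \<open>I'' = i N \<eta> I - 1\<close>, and \<open>I\<^sub>N\<close> is its bounded solution.

  The substitution \<open>s \<mapsto> N\<^sup>-\<^sup>2\<^sup>/\<^sup>3 s\<close> gives \<open>I\<^sub>N \<eta> = N\<^sup>-\<^sup>2\<^sup>/\<^sup>3 J (N\<^sup>1\<^sup>/\<^sup>3 \<eta>)\<close> with one fixed
  bounded function \<open>J\<close> satisfying \<open>J'' = i y J - 1\<close> (\<open>I_N_eq_scorer\<close>, \<open>scorer_ode\<close>). Thus the solution
  has size \<open>N\<^sup>-\<^sup>2\<^sup>/\<^sup>3\<close>, its second derivative in \<open>v\<^sub>1\<close> has size one, and the latter varies
  on the momentum scale \<open>N\<^sup>-\<^sup>1\<^sup>/\<^sup>3\<close>. At \<open>x = 0\<close>, comparing the upper left entry of the Hessian at \<open>p = 0\<close> with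
  its value at the point of the first axis where \<open>\<Phi>\<^sub>1 = a N\<^sup>-\<^sup>1\<^sup>/\<^sup>3\<close> gives a difference tending to
  \<open>Re (J'' a - J'' 0) = - a Im (J a)\<close>, over a distance comparable to \<open>N\<^sup>-\<^sup>1\<^sup>/\<^sup>3\<close>. The Hoelder quotient
  therefore grows like \<open>N\<^sup>\<alpha>\<^sup>/\<^sup>3\<close> (\<open>holder_semi_hess_f\<^sub>N_ge\<close>). A suitable \<open>a\<close> exists because the equation
  for \<open>J\<close> does not allow \<open>Im J\<close> to vanish on the positive axis (\<open>Im_scorer_nonzero\<close>).

  Along the family the solution and the forcing stay bounded, while the forcing has no momentum
  dependence at all and the coefficients are fixed, smooth and uniformly elliptic on the unit ball. So
  every quantity allowed on the right-hand side of the proposed estimates stays bounded while the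
  left-hand side does not, which rules out both the linear and the nonlinear estimate.
\<close>

section \<open>A model oscillatory integral of Airy type\<close>

text \<open>Two finite moments of the weight give a Taylor remainder that is quadratic in the increment,
  from \<open>\<bar>e\<^sup>i\<^sup>\<theta> - 1 - i\<theta>\<bar> \<le> \<theta>\<^sup>2\<close>.\<close>
lemma fourier_integral_has_vector_derivative:
  fixes w :: "real \<Rightarrow> complex"
  assumes int0: "integrable lborel w"
    and int1: "integrable lborel (\<lambda>s. of_real s * w s)"
    and int2: "integrable lborel (\<lambda>s. of_real (s\<^sup>2) * w s)"
  shows "((\<lambda>y. LINT s|lborel. w s * exp (- (\<i> * of_real (s * y)))) has_vector_derivative
           (LINT s|lborel. - (\<i> * of_real s) * w s * exp (- (\<i> * of_real (s * y))))) (at y)"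
proof -
  have meas[measurable]: "w \<in> borel_measurable lborel"
    using int0 by auto
  have unit: "cmod (exp (- (\<i> * of_real (s * x)))) = 1" for s x :: real
    by simp
  let ?F = "\<lambda>y. LINT s|lborel. w s * exp (- (\<i> * of_real (s * y)))"
  let ?D = "LINT s|lborel. - (\<i> * of_real s) * w s * exp (- (\<i> * of_real (s * y)))"
  have i0: "integrable lborel (\<lambda>s. w s * exp (- (\<i> * of_real (s * x))))" for x :: real
    by (rule Bochner_Integration.integrable_bound[OF int0]) (auto simp: norm_mult unit)
  have i1: "integrable lborel (\<lambda>s. - (\<i> * of_real s) * w s * exp (- (\<i> * of_real (s * x))))" for x :: real
    by (rule Bochner_Integration.integrable_bound[OF int1]) (auto simp: norm_mult unit)
  \<comment> \<open>The constant in the quadratic remainder is the second absolute moment of the weight.\<close>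
  define K where "K = (LINT s|lborel. cmod (of_real (s\<^sup>2) * w s))"
  have bound: "norm (?F x - ?F y - (x - y) *\<^sub>R ?D) \<le> (x - y)\<^sup>2 * K" for x
  proof -
    have "?F x - ?F y - (x - y) *\<^sub>R ?D
        = (LINT s|lborel. (w s * exp (- (\<i> * of_real (s * x))) - w s * exp (- (\<i> * of_real (s * y))))
            - (x - y) *\<^sub>R (- (\<i> * of_real s) * w s * exp (- (\<i> * of_real (s * y)))))"
      using i0 i1 by (simp only: Bochner_Integration.integral_diff Bochner_Integration.integrable_diff
          integrable_scaleR_right integral_scaleR_right)
    also have "norm \<dots> \<le> (LINT s|lborel. (x - y)\<^sup>2 * cmod (of_real (s\<^sup>2) * w s))"
    proof (rule Bochner_Integration.integral_norm_bound_integral)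
      fix s :: real
      let ?\<theta> = "- (s * (x - y))"
      have split: "exp (- (\<i> * of_real (s * x))) = exp (- (\<i> * of_real (s * y))) * exp (\<i> * of_real ?\<theta>)"
        by (simp add: exp_add [symmetric] algebra_simps)
      have taylor: "cmod (exp (\<i> * of_real ?\<theta>) - 1 - \<i> * of_real ?\<theta>) \<le> ?\<theta>\<^sup>2"
      proof -
        have "cmod (exp (\<i> * of_real ?\<theta>) - (\<Sum>k\<le>1. (\<i> * of_real ?\<theta>) ^ k / fact k)) \<le> \<bar>?\<theta>\<bar> ^ Suc 1 / fact (Suc 1)"
          by (rule iexp_approx1)
        then have "cmod (exp (\<i> * of_real ?\<theta>) - 1 - \<i> * of_real ?\<theta>) \<le> ?\<theta>\<^sup>2 / 2"
          by (simp add: numeral_2_eq_2 power_mult_distrib algebra_simps)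
        also have "\<dots> \<le> ?\<theta>\<^sup>2" by simp
        finally show ?thesis .
      qed
      have "w s * exp (- (\<i> * of_real (s * x))) - w s * exp (- (\<i> * of_real (s * y)))
            - (x - y) *\<^sub>R (- (\<i> * of_real s) * w s * exp (- (\<i> * of_real (s * y))))
          = w s * exp (- (\<i> * of_real (s * y))) * (exp (\<i> * of_real ?\<theta>) - 1 - \<i> * of_real ?\<theta>)"
        unfolding split by (simp add: algebra_simps scaleR_conv_of_real)
      then have "norm (w s * exp (- (\<i> * of_real (s * x))) - w s * exp (- (\<i> * of_real (s * y)))
            - (x - y) *\<^sub>R (- (\<i> * of_real s) * w s * exp (- (\<i> * of_real (s * y)))))
          = cmod (w s) * cmod (exp (\<i> * of_real ?\<theta>) - 1 - \<i> * of_real ?\<theta>)"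
        by (simp only: norm_mult unit mult_1_right)
      also have "\<dots> \<le> cmod (w s) * ?\<theta>\<^sup>2"
        by (rule mult_left_mono[OF taylor]) simp
      also have "\<dots> = (x - y)\<^sup>2 * cmod (of_real (s\<^sup>2) * w s)"
        by (simp add: norm_mult norm_power power_mult_distrib)
      finally show "norm (w s * exp (- (\<i> * of_real (s * x))) - w s * exp (- (\<i> * of_real (s * y)))
            - (x - y) *\<^sub>R (- (\<i> * of_real s) * w s * exp (- (\<i> * of_real (s * y)))))
          \<le> (x - y)\<^sup>2 * cmod (of_real (s\<^sup>2) * w s)" .
    next
      show "integrable lborel (\<lambda>s. (w s * exp (- (\<i> * of_real (s * x))) - w s * exp (- (\<i> * of_real (s * y))))
            - (x - y) *\<^sub>R (- (\<i> * of_real s) * w s * exp (- (\<i> * of_real (s * y)))))"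
        by (intro Bochner_Integration.integrable_diff integrable_scaleR_right i0 i1)
      show "integrable lborel (\<lambda>s. (x - y)\<^sup>2 * cmod (of_real (s\<^sup>2) * w s))"
        by (intro integrable_mult_right integrable_norm int2)
    qed
    also have "\<dots> = (x - y)\<^sup>2 * K"
      unfolding K_def by (rule integral_mult_right_zero)
    finally show ?thesis .
  qed
  show ?thesis
    unfolding has_vector_derivative_def
  proof (rule has_derivativeI_sandwich[of 1])
    show "norm (?F x - ?F y - (x - y) *\<^sub>R ?D) / norm (x - y) \<le> \<bar>x - y\<bar> * K" if "x \<noteq> y" for x
      using bound[of x] that by (simp add: field_simps power2_eq_square abs_mult_self_eq flip: abs_mult)
    show "((\<lambda>x. \<bar>x - y\<bar> * K) \<longlongrightarrow> 0) (at y within UNIV)"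
      by (auto intro!: tendsto_eq_intros)
  qed (simp_all only: bounded_linear_scaleR_left zero_less_one)
qed

text \<open>This is the \<open>n\<close>-th derivative of \<open>y \<mapsto> \<pi> Hi (- i y)\<close>, where
  \<open>Hi\<close> is the Scorer function. The index records the derivative, so that all smoothness
  statements concern one family of integrals.\<close>
definition scorer :: "nat \<Rightarrow> real \<Rightarrow> complex" where
  "scorer n y = (LINT s:{0..}|lborel.
     (- (\<i> * of_real s)) ^ n * of_real (exp (- (s ^ 3 / 3))) * exp (- (\<i> * of_real (s * y))))"

definition scorer_weight :: "nat \<Rightarrow> real \<Rightarrow> complex" where
  "scorer_weight n s = indicat_real {0..} s *\<^sub>R ((- (\<i> * of_real s)) ^ n * of_real (exp (- (s ^ 3 / 3))))"

lemma scorer_eq: "scorer n y = (LINT s|lborel. scorer_weight n s * exp (- (\<i> * of_real (s * y))))"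
  by (simp add: scorer_def scorer_weight_def set_lebesgue_integral_def)

text \<open>On the half-line \<open>s\<^sup>3 - 3 s + 2 = (s - 1)\<^sup>2 (s + 2) \<ge> 0\<close>, so the
  cubic exponential is dominated by \<open>e\<^sup>2\<^sup>/\<^sup>3 e\<^sup>-\<^sup>s\<close> and all
  moments are finite.\<close>
lemma integrable_scorer_weight: "integrable lborel (scorer_weight n)"
proof (rule Bochner_Integration.integrable_bound)
  show "integrable lborel (\<lambda>s. exp (2 / 3) * (indicator {0..} s * (s ^ n * exp (- s)) :: real))"
  proof (rule integrable_mult_right, rule integrableI_nonneg)
    show "(\<integral>\<^sup>+ x. ennreal (indicator {0..} x * (x ^ n * exp (- x))) \<partial>lborel) < \<infinity>"
      using nn_intergal_power_times_exp_Ici[of n]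
      by (simp add: mult.commute indicator_mult_ennreal)
  qed (auto split: split_indicator)
  show "AE s in lborel. norm (scorer_weight n s) \<le> norm (exp (2 / 3) * (indicator {0..} s * (s ^ n * exp (- s)) :: real))"
  proof (intro AE_I2)
    fix s :: real
    have "exp (- (s ^ 3 / 3)) \<le> exp (2 / 3) * exp (- s)" if "s \<ge> 0"
    proof -
      have "0 \<le> (s - 1)\<^sup>2 * (s + 2)" using that by simp
      then have "- (s ^ 3 / 3) \<le> 2 / 3 + - s" by (simp add: power2_eq_square power3_eq_cube algebra_simps)
      then show ?thesis by (simp flip: exp_add)
    qed
    then show "norm (scorer_weight n s) \<le> norm (exp (2 / 3) * (indicator {0..} s * (s ^ n * exp (- s)) :: real))"
      by (auto simp: scorer_weight_def norm_mult norm_power mult_left_mono algebra_simps split: split_indicator)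
  qed
qed (auto simp: scorer_weight_def[abs_def])

lemma scorer_has_vector_derivative:
  "(scorer n has_vector_derivative scorer (Suc n) y) (at y)"
proof -
  have step: "of_real s * scorer_weight n s = \<i> * scorer_weight (Suc n) s" for n s
    proof -
    have "scorer_weight (Suc n) s = - (\<i> * of_real s) * scorer_weight n s"
      by (simp only: scorer_weight_def scaleR_conv_of_real power_Suc mult_ac)
    then show ?thesis
      by (simp add: mult.assoc[symmetric])
  qed
  have "integrable lborel (\<lambda>s. of_real s * scorer_weight n s)"
    by (simp add: step integrable_scorer_weight)
  moreover have "integrable lborel (\<lambda>s. of_real (s\<^sup>2) * scorer_weight n s)"
  proof -
    have "of_real (s\<^sup>2) * scorer_weight n s = - scorer_weight (Suc (Suc n)) s" for s
      by (simp add: power2_eq_square step mult.left_commute mult.assoc)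
    then show ?thesis by (simp add: integrable_scorer_weight)
  qed
  ultimately show ?thesis
    using fourier_integral_has_vector_derivative[OF integrable_scorer_weight, of n y]
    unfolding scorer_eq[abs_def]
    by (simp add: step scorer_weight_def scaleR_conv_of_real mult_ac)
qed

lemma cmod_scorer_le: "cmod (scorer n y) \<le> (LINT s|lborel. cmod (scorer_weight n s))"
  unfolding scorer_eq
proof (rule Bochner_Integration.integral_norm_bound_integral)
  show "integrable lborel (\<lambda>s. scorer_weight n s * exp (- (\<i> * of_real (s * y))))"
    by (rule Bochner_Integration.integrable_bound[OF integrable_scorer_weight[of n]])
      (auto simp: norm_mult scorer_weight_def)
qed (auto simp: integrable_scorer_weight norm_mult)

text \<open>The combination \<open>(s\<^sup>2 + i y) exp (- s\<^sup>3 / 3 - i s y)\<close> is minus a total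
  derivative in \<open>s\<close>. Its integral over the half-line is the boundary value at zero, which is
  the source of the inhomogeneity.\<close>
lemma scorer_ode: "scorer 2 y = \<i> * of_real y * scorer 0 y - 1"
proof -
  let ?E = "\<lambda>s. exp (- (of_real (s ^ 3 / 3) + \<i> * of_real (s * y))) :: complex"
  let ?g = "\<lambda>s. - ((of_real (s\<^sup>2) + \<i> * of_real y) * ?E s)"
  have int: "integrable lborel (\<lambda>s. scorer_weight n s * exp (- (\<i> * of_real (s * y))))" for n
    by (rule Bochner_Integration.integrable_bound[OF integrable_scorer_weight[of n]])
      (auto simp: norm_mult scorer_weight_def)
  have E_eq: "?E s = of_real (exp (- (s ^ 3 / 3))) * exp (- (\<i> * of_real (s * y)))" for s
    by (simp flip: exp_of_real exp_add)
  have eq: "indicator {0..} s *\<^sub>R ?g s = scorer_weight 2 s * exp (- (\<i> * of_real (s * y)))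
        - \<i> * of_real y * (scorer_weight 0 s * exp (- (\<i> * of_real (s * y))))" for s
    unfolding E_eq by (auto simp: scorer_weight_def power_mult_distrib algebra_simps split: split_indicator)
  have ints: "integrable lborel (\<lambda>s. indicator {0..} s *\<^sub>R ?g s)"
    unfolding eq by (intro Bochner_Integration.integrable_diff integrable_mult_right int)
  have val: "(LINT s:{0..}|lborel. ?g s) = scorer 2 y - \<i> * of_real y * scorer 0 y"
    unfolding set_lebesgue_integral_def eq scorer_eq
    using int by (simp add: Bochner_Integration.integral_diff)
  have "(LBINT s=0..\<infinity>. ?g s) = 0 - 1"
  proof (rule interval_integral_FTC_integrable)
    show "(?E has_vector_derivative ?g s) (at s)" for s
    proof -
      have "((\<lambda>z. exp (- (z ^ 3 / 3 + \<i> * (z * of_real y)))) has_field_derivative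
          - ((of_real s ^ 2 + \<i> * of_real y) * exp (- (of_real s ^ 3 / 3 + \<i> * (of_real s * of_real y)))))
          (at (of_real s))"
        by (auto intro!: derivative_eq_intros simp: algebra_simps)
      from has_vector_derivative_real_field[OF this] show ?thesis
        by simp
    qed
    show "isCont ?g s" for s
      by (intro continuous_intros) auto
    show "set_integrable lborel (einterval 0 \<infinity>) ?g"
      by (rule set_integrable_subset[of _ "{0..}"]) (use ints in \<open>auto simp: set_integrable_def einterval_iff zero_ereal_def\<close>)
    have "(?E \<longlongrightarrow> ?E 0) (at_right 0)"
      by (intro tendsto_intros) auto
    then show "((?E \<circ> real_of_ereal) \<longlongrightarrow> 1) (at_right 0)"
      by (simp add: zero_ereal_def ereal_tendsto_simps)
    have "((\<lambda>s. exp (- (s ^ 3 / 3)) :: real) \<longlongrightarrow> 0) at_top"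
      by real_asymp
    then have "(?E \<longlongrightarrow> 0) at_top"
      by (intro tendsto_norm_zero_cancel[of ?E]) (simp add: E_eq norm_mult)
    then show "((?E \<circ> real_of_ereal) \<longlongrightarrow> 0) (at_left \<infinity>)"
      by (simp add: ereal_tendsto_simps)
  qed auto
  moreover have "(LBINT s=0..\<infinity>. ?g s) = (LINT s:{0..}|lborel. ?g s)"
  proof -
    have "(LBINT s=0..\<infinity>. ?g s) = (LINT s:{0<..}|lborel. ?g s)"
      by (simp add: interval_lebesgue_integral_def zero_ereal_def)
    also have "\<dots> = (LINT s:{0..}|lborel. ?g s)"
      unfolding set_lebesgue_integral_def
    proof (rule integral_cong_AE)
      show "AE s in lborel. indicator {0<..} s *\<^sub>R ?g s = indicator {0..} s *\<^sub>R ?g s"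
        using AE_lborel_singleton[of "0 :: real"] by eventually_elim (auto simp: indicator_def)
    qed measurable
    finally show ?thesis .
  qed
  ultimately have "scorer 2 y - \<i> * of_real y * scorer 0 y = 0 - 1"
    by (metis val)
  then show ?thesis
    by (simp add: algebra_simps)
qed

section \<open>The integrals as rescalings of the model\<close>

text \<open>The \<open>n\<close>-th derivative of \<open>I\<^sub>N\<close> in \<open>\<eta>\<close>, written
  through the model integrals. Each derivative costs one factor
  \<open>N\<^sup>1\<^sup>/\<^sup>3\<close>.\<close>
definition I_derivative :: "real \<Rightarrow> nat \<Rightarrow> real \<Rightarrow> complex" where
  "I_derivative N n \<eta> = of_real ((N powr (1 / 3)) ^ n * N powr (- 2 / 3)) * scorer n (N powr (1 / 3) * \<eta>)"

text \<open>With \<open>c = N\<^sup>-\<^sup>2\<^sup>/\<^sup>3\<close> one has \<open>N\<^sup>2 c\<^sup>3 =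
  1\<close>, so the substitution \<open>s \<mapsto> c s\<close> removes \<open>N\<close> from the cubic
  phase and leaves \<open>N c = N\<^sup>1\<^sup>/\<^sup>3\<close> in the linear one.\<close>
lemma I_N_eq_scorer:
  assumes "N > 0"
  shows "I\<^sub>N N \<eta> = I_derivative N 0 \<eta>"
proof -
  define c where "c = N powr (- 2 / 3)"
  have c: "c > 0" "N\<^sup>2 * c ^ 3 = 1" "N * c = N powr (1 / 3)"
  proof -
    have "c ^ 3 = N powr (-2)"
      using assms by (simp add: c_def powr_power)
    then show "N\<^sup>2 * c ^ 3 = 1"
      using assms by (simp add: powr_minus)
    show "N * c = N powr (1 / 3)"
      using assms powr_add[of N 1 "-2/3"] by (simp add: c_def)
  qed (use assms in \<open>simp add: c_def\<close>)
  let ?f = "\<lambda>s. indicator {0..} s *\<^sub>R (complex_of_real (exp (- (N\<^sup>2 * s ^ 3 / 3)))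
      * exp (- (\<i> * complex_of_real (N * s * \<eta>))))"
  have scale: "?f (0 + c * s) = scorer_weight 0 s * exp (- (\<i> * of_real (s * (N powr (1 / 3) * \<eta>))))" for s
  proof -
    have "N\<^sup>2 * (c * s) ^ 3 = (N\<^sup>2 * c ^ 3) * s ^ 3"
      by (simp add: power_mult_distrib)
    moreover have "N * (c * s) * \<eta> = s * ((N * c) * \<eta>)"
      by simp
    moreover have "indicator {0..} (c * s) = (indicator {0..} s :: real)"
      using c(1) by (auto simp: indicator_def zero_le_mult_iff)
    ultimately show ?thesis
      unfolding c by (simp only: add_0 scorer_weight_def) simp
  qed
  have "I\<^sub>N N \<eta> = (LINT s|lborel. ?f s)"
    by (simp add: I\<^sub>N_def set_lebesgue_integral_def)
  also have "\<dots> = \<bar>c\<bar> *\<^sub>R (LINT s|lborel. ?f (0 + c * s))"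
    by (rule lborel_integral_real_affine) (use c in simp)
  also have "\<dots> = I_derivative N 0 \<eta>"
    unfolding scale using c(1) by (simp add: scorer_eq I_derivative_def scaleR_conv_of_real c_def)
  finally show ?thesis .
qed

lemma I_derivative_has_vector_derivative:
  "(I_derivative N n has_vector_derivative I_derivative N (Suc n) \<eta>) (at \<eta>)"
proof -
  let ?m = "N powr (1 / 3)"
  have "((\<lambda>x. ?m * x) has_vector_derivative ?m) (at \<eta>)"
    by (auto intro!: derivative_eq_intros)
  from vector_diff_chain_at[OF this scorer_has_vector_derivative[of n]]
  have "((\<lambda>x. scorer n (?m * x)) has_vector_derivative ?m *\<^sub>R scorer (Suc n) (?m * \<eta>)) (at \<eta>)"
    by (simp add: o_def)
  from has_vector_derivative_mult_right[OF this, of "of_real (?m ^ n * N powr (- 2 / 3))"] show ?thesis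
    unfolding I_derivative_def[abs_def] by (simp add: scaleR_conv_of_real mult_ac)
qed

lemma Re_I_derivative:
  "((\<lambda>\<eta>. Re (I_derivative N n \<eta>)) has_real_derivative Re (I_derivative N (Suc n) \<eta>)) (at \<eta>)"
  using bounded_linear.has_vector_derivative[OF bounded_linear_Re I_derivative_has_vector_derivative[of N n \<eta>]]
  by (simp add: has_real_derivative_iff_has_vector_derivative)

lemma Im_I_derivative:
  "((\<lambda>\<eta>. Im (I_derivative N n \<eta>)) has_real_derivative Im (I_derivative N (Suc n) \<eta>)) (at \<eta>)"
  using bounded_linear.has_vector_derivative[OF bounded_linear_Im I_derivative_has_vector_derivative[of N n \<eta>]]
  by (simp add: has_real_derivative_iff_has_vector_derivative)

lemma I_derivative_ode:
  assumes "N > 0"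
  shows "I_derivative N 2 \<eta> = \<i> * of_real (N * \<eta>) * I_derivative N 0 \<eta> - 1"
proof -
  have m1: "(N powr (1 / 3))\<^sup>2 * N powr (- 2 / 3) = 1"
    using assms by (simp add: powr_power flip: powr_add)
  have m2: "N powr (1 / 3) = N * N powr (- 2 / 3)"
    using assms powr_add[of N 1 "-2/3"] by simp
  have "I_derivative N 2 \<eta> = scorer 2 (N powr (1 / 3) * \<eta>)"
    unfolding I_derivative_def m1 by simp
  also have "\<dots> = \<i> * of_real ((N * N powr (- 2 / 3)) * \<eta>) * scorer 0 (N powr (1 / 3) * \<eta>) - 1"
    unfolding scorer_ode m2[symmetric] by simp
  also have "\<dots> = \<i> * of_real (N * \<eta>) * I_derivative N 0 \<eta> - 1"
    by (simp add: I_derivative_def)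
  finally show ?thesis .
qed

lemma cmod_I_N_le:
  "\<exists>C>0. \<forall>N>0. \<forall>\<eta>. cmod (I\<^sub>N N \<eta>) \<le> C * N powr (- 2 / 3)"
proof -
  \<comment> \<open>The summand \<open>1\<close> makes the constant positive without evaluating the integral.\<close>
  define C where "C = (LINT s|lborel. cmod (scorer_weight 0 s)) + 1"
  have "cmod (I\<^sub>N N \<eta>) \<le> C * N powr (- 2 / 3)" if "N > 0" for N \<eta>
  proof -
    have "cmod (I\<^sub>N N \<eta>) = N powr (- 2 / 3) * cmod (scorer 0 (N powr (1 / 3) * \<eta>))"
      using that by (simp add: I_N_eq_scorer I_derivative_def norm_mult)
    also have "\<dots> \<le> N powr (- 2 / 3) * C"
      using cmod_scorer_le[of 0 "N powr (1 / 3) * \<eta>"] by (intro mult_left_mono) (auto simp: C_def)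
    finally show ?thesis by (simp add: mult.commute)
  qed
  moreover have "C > 0"
    unfolding C_def by (rule add_nonneg_pos) auto
  ultimately show ?thesis by blast
qed

lemma derivative_vanishes_on_positive:
  fixes f :: "real \<Rightarrow> real"
  assumes "\<And>x. (f has_real_derivative f' x) (at x)" "\<And>x. x > 0 \<Longrightarrow> f x = 0" "x > 0"
  shows "f' x = 0"
proof -
  have "((\<lambda>_. 0) has_real_derivative f' x) (at x)"
    by (rule has_field_derivative_transform_within_open[OF assms(1), where S = "{0<..}"]) (use assms(2,3) in auto)
  then show ?thesis
    using DERIV_const DERIV_unique by blast
qed

text \<open>Write \<open>J\<close> for \<open>scorer 0\<close>. If its imaginary part vanished on the
  positive axis, then so would that of the second derivative, which by the differential equation is \<open>y
  Re J\<close>. Hence \<open>Re J\<close> and its derivatives would vanish too, but \<open>Re J'' = - y Im J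
  - 1\<close> would then equal \<open>-1\<close>.\<close>
lemma Im_scorer_nonzero: "\<exists>a>0. Im (scorer 0 a) \<noteq> 0"
proof (rule ccontr)
  assume "\<not> (\<exists>a>0. Im (scorer 0 a) \<noteq> 0)"
  then have im0: "Im (scorer 0 a) = 0" if "a > 0" for a
    using that by blast
  have re: "((\<lambda>y. Re (scorer n y)) has_real_derivative Re (scorer (Suc n) y)) (at y)"
    and im: "((\<lambda>y. Im (scorer n y)) has_real_derivative Im (scorer (Suc n) y)) (at y)" for n y
    using bounded_linear.has_vector_derivative[OF bounded_linear_Re scorer_has_vector_derivative[of n y]]
      bounded_linear.has_vector_derivative[OF bounded_linear_Im scorer_has_vector_derivative[of n y]]
    by (simp_all add: has_real_derivative_iff_has_vector_derivative)
  have im1: "Im (scorer 1 a) = 0" if "a > 0" for a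
    using derivative_vanishes_on_positive[OF im[of 0] im0 that] by simp
  have im2: "Im (scorer 2 a) = 0" if "a > 0" for a
    using derivative_vanishes_on_positive[OF im[of 1] im1 that] by (simp add: numeral_2_eq_2)
  have re0: "Re (scorer 0 a) = 0" if "a > 0" for a
    using im2[OF that] that by (simp add: scorer_ode)
  have re1: "Re (scorer 1 a) = 0" if "a > 0" for a
    using derivative_vanishes_on_positive[OF re[of 0] re0 that] by simp
  have "Re (scorer 2 1) = 0"
    using derivative_vanishes_on_positive[OF re[of 1] re1, of 1] by (simp add: numeral_2_eq_2)
  then show False
    using im0[of 1] by (simp add: scorer_ode)
qed

section \<open>Smooth functions\<close>

lemma frechet_derivative_eq: "(f has_derivative f') (at x) \<Longrightarrow> frechet_derivative f (at x) = f'"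
  by (rule frechet_derivative_at[symmetric])

text \<open>The coefficients and the solutions are smooth on the whole space, where the directional
  derivatives are again globally smooth functions. Inductions on the order of differentiability then need no
  restriction of domains.\<close>
definition smooth :: "('a::euclidean_space \<Rightarrow> 'b::real_normed_vector) \<Rightarrow> bool" where
  "smooth f \<longleftrightarrow> (\<forall>k. Ck_on k UNIV f)"

lemma smooth_imp_smooth_on: "smooth f \<Longrightarrow> smooth_on S f"
  unfolding smooth_on_def smooth_def by (rule exI[of _ UNIV], rule exI[of _ f]) auto

lemma Ck_on_SucD: "Ck_on (Suc k) U f \<Longrightarrow> Ck_on k U f"
proof (induction k arbitrary: f)
  case 0
  then show ?case
    by (auto intro!: differentiable_imp_continuous_on simp: differentiable_on_def differentiable_at_withinI)
qed auto

lemma smooth_differentiable: "smooth f \<Longrightarrow> f differentiable (at z)"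
  unfolding smooth_def by (metis Ck_on.simps(2) UNIV_I)

lemma smooth_has_derivative: "smooth f \<Longrightarrow> (f has_derivative frechet_derivative f (at z)) (at z)"
  using smooth_differentiable frechet_derivative_works by blast

lemma smooth_imp_continuous: "smooth f \<Longrightarrow> continuous_on S f"
  by (simp add: smooth_differentiable differentiable_imp_continuous_on differentiable_on_def differentiable_at_withinI)

lemma smooth_directional_derivative: "smooth f \<Longrightarrow> smooth (\<lambda>z. frechet_derivative f (at z) v)"
  unfolding smooth_def by (metis Ck_on.simps(2))

lemma Ck_on_SucI:
  assumes "\<And>z. (f has_derivative f' z) (at z)" and "\<And>v. Ck_on k UNIV (\<lambda>z. f' z v)"
  shows "Ck_on (Suc k) UNIV f"
  using assms frechet_derivative_eq[OF assms(1)] by (auto simp: differentiable_def)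

lemma Ck_on_const: "Ck_on k UNIV (\<lambda>_. c)"
proof (induction k arbitrary: c)
  case (Suc k)
  show ?case by (rule Ck_on_SucI[where f' = "\<lambda>_ _. 0"]) (use Suc in auto)
qed auto

lemma smooth_const: "smooth (\<lambda>_. c)"
  by (simp add: smooth_def Ck_on_const)

lemma smooth_bounded_linear:
  assumes "bounded_linear f" shows "smooth f"
  unfolding smooth_def
proof
  show "Ck_on k UNIV f" for k
  proof (cases k)
    case 0
    then show ?thesis using assms by (simp add: linear_continuous_on)
  next
    case (Suc j)
    show ?thesis unfolding Suc
      by (rule Ck_on_SucI[where f' = "\<lambda>_. f"]) (auto simp: Ck_on_const bounded_linear_imp_has_derivative assms)
  qed
qed

lemma Ck_on_add: "Ck_on k UNIV f \<Longrightarrow> Ck_on k UNIV g \<Longrightarrow> Ck_on k UNIV (\<lambda>z. f z + g z)"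
proof (induction k arbitrary: f g)
  case 0
  then show ?case by (auto intro: continuous_on_add)
next
  case (Suc k)
  show ?case
    by (rule Ck_on_SucI[where f' = "\<lambda>z v. frechet_derivative f (at z) v + frechet_derivative g (at z) v"])
      (use Suc in \<open>auto intro!: has_derivative_add simp flip: frechet_derivative_works\<close>)
qed

lemma smooth_add: "smooth f \<Longrightarrow> smooth g \<Longrightarrow> smooth (\<lambda>z. f z + g z)"
  by (simp add: smooth_def Ck_on_add)

lemma (in bounded_bilinear) Ck_on_bilinear:
  "Ck_on k UNIV f \<Longrightarrow> Ck_on k UNIV g \<Longrightarrow> Ck_on k UNIV (\<lambda>z. prod (f z) (g z))"
proof (induction k arbitrary: f g)
  case 0
  then show ?case by (auto intro: continuous_on)
next
  case (Suc k)
  show ?case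
  proof (rule Ck_on_SucI[where f' = "\<lambda>z v. prod (f z) (frechet_derivative g (at z) v)
        + prod (frechet_derivative f (at z) v) (g z)"])
    show "((\<lambda>z. prod (f z) (g z)) has_derivative (\<lambda>v. prod (f z) (frechet_derivative g (at z) v)
        + prod (frechet_derivative f (at z) v) (g z))) (at z)" for z
      by (rule FDERIV) (use Suc.prems in \<open>auto simp flip: frechet_derivative_works\<close>)
    show "Ck_on k UNIV (\<lambda>z. prod (f z) (frechet_derivative g (at z) v)
        + prod (frechet_derivative f (at z) v) (g z))" for v
      using Suc.prems by (intro Ck_on_add Suc.IH) (auto intro: Ck_on_SucD)
  qed
qed

lemma smooth_bilinear: "bounded_bilinear b \<Longrightarrow> smooth f \<Longrightarrow> smooth g \<Longrightarrow> smooth (\<lambda>z. b (f z) (g z))"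
  by (simp add: smooth_def bounded_bilinear.Ck_on_bilinear)

lemma smooth_mult:
  fixes f g :: "'a::euclidean_space \<Rightarrow> real"
  shows "smooth f \<Longrightarrow> smooth g \<Longrightarrow> smooth (\<lambda>z. f z * g z)"
  by (rule smooth_bilinear[OF bounded_bilinear_mult])

text \<open>The outer function is given with all its derivatives as a sequence. The chain rule turns
  \<open>G n\<close> into \<open>G (Suc n)\<close> times a smooth factor, so an induction on the order,
  uniform in \<open>n\<close>, applies.\<close>
lemma smooth_compose_real:
  fixes f :: "'a::euclidean_space \<Rightarrow> real" and G :: "nat \<Rightarrow> real \<Rightarrow> real"
  assumes G: "\<And>n y. y \<in> S \<Longrightarrow> (G n has_real_derivative G (Suc n) y) (at y)"
    and f: "smooth f" "\<And>z. f z \<in> S"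
  shows "smooth (\<lambda>z. G n (f z))"
proof -
  have chain: "((\<lambda>z. G n (f z)) has_derivative (\<lambda>v. G (Suc n) (f z) * frechet_derivative f (at z) v)) (at z)" for n z
    using has_derivative_compose[OF smooth_has_derivative[OF f(1)] has_field_derivative_imp_has_derivative[OF G[OF f(2)]]]
    by simp
  have "Ck_on k UNIV (\<lambda>z. G n (f z))" for k
  proof (induction k arbitrary: n)
    case 0
    have "(\<lambda>z. G n (f z)) differentiable (at z)" for z
      using chain by (auto simp: differentiable_def)
    then show ?case
      by (auto intro!: differentiable_imp_continuous_on simp: differentiable_on_def)
  next
    case (Suc k)
    show ?case
      using f(1) smooth_directional_derivative
      by (intro Ck_on_SucI[OF chain] bounded_bilinear.Ck_on_bilinear[OF bounded_bilinear_mult] Suc)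
        (auto simp: smooth_def)
  qed
  then show ?thesis by (simp add: smooth_def)
qed

lemma smooth_powr:
  fixes f :: "'a::euclidean_space \<Rightarrow> real"
  assumes "smooth f" "\<And>z. f z > 0"
  shows "smooth (\<lambda>z. f z powr a)"
proof -
  let ?G = "\<lambda>n y. (\<Prod>i<n. a - real i) * y powr (a - real n)"
  have "smooth (\<lambda>z. ?G 0 (f z))"
  proof (rule smooth_compose_real[where S = "{0<..}" and G = ?G])
    show "(?G n has_real_derivative ?G (Suc n) y) (at y)" if "y \<in> {0<..}" for n y
      using that by (auto intro!: derivative_eq_intros simp: algebra_simps)
  qed (use assms in auto)
  then show ?thesis by simp
qed

text \<open>The shift \<open>c\<close> makes the family closed under differentiation, each derivative adding
  \<open>\<pi> / 2\<close>. It also covers the sine.\<close>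
lemma smooth_cos:
  fixes f :: "'a::euclidean_space \<Rightarrow> real"
  assumes "smooth f"
  shows "smooth (\<lambda>z. cos (f z + c))"
proof -
  have "smooth (\<lambda>z. (\<lambda>n y. cos (y + c + real n * (pi / 2))) 0 (f z))"
    by (rule smooth_compose_real[where S = UNIV and G = "\<lambda>n y. cos (y + c + real n * (pi / 2))"])
      (use assms in \<open>auto intro!: derivative_eq_intros simp: algebra_simps cos_add sin_add add_divide_distrib\<close>)
  then show ?thesis by simp
qed

text \<open>The directional derivatives along a basis are continuous, hence bounded on the compact set.
  Their sum bounds the operator norm of the derivative.\<close>
lemma smooth_lipschitz_on_compact:
  fixes f :: "'a::euclidean_space \<Rightarrow> 'b::real_normed_vector"
  assumes f: "smooth f" and K: "compact K" "convex K"
  shows "\<exists>L\<ge>0. \<forall>x\<in>K. \<forall>y\<in>K. norm (f x - f y) \<le> L * norm (x - y)"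
proof -
  have "\<exists>M. \<forall>z\<in>K. norm (frechet_derivative f (at z) b) \<le> M" for b
    using compact_imp_bounded[OF compact_continuous_image[OF smooth_imp_continuous[OF smooth_directional_derivative[OF f]] K(1)]]
    unfolding bounded_iff by blast
  then obtain M where M: "\<And>b z. z \<in> K \<Longrightarrow> norm (frechet_derivative f (at z) b) \<le> M b"
    by metis
  define L where "L = (\<Sum>b\<in>Basis. \<bar>M b\<bar>)"
  have "onorm (frechet_derivative f (at z)) \<le> L" if "z \<in> K" for z
  proof (rule onorm_le)
    fix v :: 'a
    interpret D: bounded_linear "frechet_derivative f (at z)"
      by (rule has_derivative_bounded_linear[OF smooth_has_derivative[OF f]])
    have "frechet_derivative f (at z) v = frechet_derivative f (at z) (\<Sum>b\<in>Basis. (v \<bullet> b) *\<^sub>R b)"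
      by (simp add: euclidean_representation)
    also have "\<dots> = (\<Sum>b\<in>Basis. (v \<bullet> b) *\<^sub>R frechet_derivative f (at z) b)"
      by (simp add: D.sum D.scaleR)
    also have "norm \<dots> \<le> (\<Sum>b\<in>Basis. norm v * \<bar>M b\<bar>)"
    proof (rule sum_norm_le)
      show "norm ((v \<bullet> b) *\<^sub>R frechet_derivative f (at z) b) \<le> norm v * \<bar>M b\<bar>" if "b \<in> Basis" for b
        using M[OF \<open>z \<in> K\<close>, of b] Basis_le_norm[OF that, of v] by (auto intro!: mult_mono)
    qed
    finally show "norm (frechet_derivative f (at z) v) \<le> L * norm v"
      by (simp add: L_def mult.commute flip: sum_distrib_left)
  qed
  then have "norm (f x - f y) \<le> L * norm (x - y)" if "x \<in> K" "y \<in> K" for x y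
    using differentiable_bound[OF K(2), of f "\<lambda>z. frechet_derivative f (at z)" L x y] that
      has_derivative_at_withinI[OF smooth_has_derivative[OF f]] by blast
  moreover have "L \<ge> 0" unfolding L_def by (simp add: sum_nonneg)
  ultimately show ?thesis by blast
qed

section \<open>The velocity map and the coefficients\<close>

lemma gradient_eqI:
  assumes "(g has_derivative (\<lambda>h. v \<bullet> h)) (at x)"
  shows "gradient g x = v"
  unfolding gradient_def frechet_derivative_at[OF assms, symmetric]
  by (simp add: vec_eq_iff inner_axis)

lemma hessian_eqI:
  assumes "(gradient g has_derivative (\<lambda>h. H *v h)) (at x)"
  shows "hessian g x = H"
  unfolding hessian_def jacobian_def frechet_derivative_at[OF assms, symmetric] by simp

lemma japanese_sq: "(japanese p)\<^sup>2 = 1 + p \<bullet> p"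
  by (simp add: japanese_def power2_norm_eq_inner add_nonneg_nonneg)

lemma japanese_pos: "japanese p > 0"
  by (simp add: japanese_def add_pos_nonneg)

lemma japanese_has_derivative: "(japanese has_derivative (\<lambda>h. (p \<bullet> h) / japanese p)) (at p)"
proof -
  have eq: "japanese q = sqrt (1 + q \<bullet> q)" for q
    by (simp add: japanese_def power2_norm_eq_inner)
  have pos: "1 + p \<bullet> p > 0"
    by (simp add: add_pos_nonneg)
  have "((\<lambda>q. 1 + q \<bullet> q) has_derivative (\<lambda>h. 2 * (p \<bullet> h))) (at p)"
    by (auto intro!: derivative_eq_intros simp: inner_commute)
  from has_derivative_real_sqrt[OF _ this] pos show ?thesis
    by (simp add: eq[abs_def] field_simps)
qed

text \<open>The gradient and, below, the Hessian of the first component of \<open>\<Phi>\<close>. Writing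
  them with rank-one matrices lets the traces against \<open>A\<^sub>0\<close> reduce to scalar
  products.\<close>
definition grad_\<Phi>1 :: "vec3 \<Rightarrow> vec3" where
  "grad_\<Phi>1 p = inverse (japanese p) *\<^sub>R axis 1 1 - (p $ 1 * inverse (japanese p) ^ 3) *\<^sub>R p"

definition hess_\<Phi>1 :: "vec3 \<Rightarrow> mat3" where
  "hess_\<Phi>1 p = (3 * p $ 1 * inverse (japanese p) ^ 5) *\<^sub>R outer p p
     - (inverse (japanese p) ^ 3) *\<^sub>R (outer (axis 1 1) p + outer p (axis 1 1) + p $ 1 *\<^sub>R mat 1)"

lemma outer_mult_vector: "outer a b *v h = (b \<bullet> h) *\<^sub>R a"
  by (simp add: outer_def matrix_vector_mult_def inner_vec_def vec_eq_iff sum_distrib_left mult_ac)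

lemma inverse_japanese_has_derivative:
  "((\<lambda>q. inverse (japanese q)) has_derivative (\<lambda>h. - (inverse (japanese p) ^ 3 * (p \<bullet> h)))) (at p)"
  using japanese_pos[of p]
  by (auto intro!: derivative_eq_intros japanese_has_derivative simp: field_simps power3_eq_cube)

lemma \<Phi>1_has_derivative: "((\<lambda>q. \<Phi> q $ 1) has_derivative (\<lambda>h. grad_\<Phi>1 p \<bullet> h)) (at p)"
proof -
  have "((\<lambda>q. inverse (japanese q) * q $ 1) has_derivative
      (\<lambda>h. inverse (japanese p) * h $ 1 + - (inverse (japanese p) ^ 3 * (p \<bullet> h)) * p $ 1)) (at p)"
    by (rule has_derivative_mult[OF inverse_japanese_has_derivative
          bounded_linear.has_derivative[OF bounded_linear_vec_nth has_derivative_ident]])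
  moreover have "(\<lambda>q. \<Phi> q $ 1) = (\<lambda>q. inverse (japanese q) * q $ 1)"
    by (simp add: \<Phi>_def)
  moreover have "(\<lambda>h. grad_\<Phi>1 p \<bullet> h)
      = (\<lambda>h. inverse (japanese p) * h $ 1 + - (inverse (japanese p) ^ 3 * (p \<bullet> h)) * p $ 1)"
    by (simp add: grad_\<Phi>1_def inner_diff_left inner_axis' fun_eq_iff)
  ultimately show ?thesis
    by simp
qed

lemma grad_\<Phi>1_has_derivative: "(grad_\<Phi>1 has_derivative (\<lambda>h. hess_\<Phi>1 p *v h)) (at p)"
proof -
  have "((\<lambda>p. inverse (japanese p) *\<^sub>R axis 1 1 - (p $ 1 * inverse (japanese p) ^ 3) *\<^sub>R p) has_derivative
     (\<lambda>h. - (inverse (japanese p) ^ 3 * (p \<bullet> h)) *\<^sub>R axis 1 1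
       - ((p $ 1 * inverse (japanese p) ^ 3) *\<^sub>R h
          + (p $ 1 * (of_nat 3 * - (inverse (japanese p) ^ 3 * (p \<bullet> h)) * inverse (japanese p) ^ (3 - 1))
             + h $ 1 * inverse (japanese p) ^ 3) *\<^sub>R p))) (at p)"
    by (intro has_derivative_diff has_derivative_scaleR has_derivative_scaleR_left has_derivative_mult
        has_derivative_power has_derivative_ident inverse_japanese_has_derivative
        bounded_linear.has_derivative[OF bounded_linear_vec_nth])
  then show ?thesis
    unfolding grad_\<Phi>1_def[abs_def]
    by (rule has_derivative_eq_rhs)
      (simp add: hess_\<Phi>1_def fun_eq_iff matrix_vector_mult_add_rdistrib matrix_vector_mult_diff_rdistrib
        scaleR_matrix_vector_assoc[symmetric] outer_mult_vector inner_axis' vec_eq_iff eval_nat_numeral algebra_simps)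
qed

lemma gradient_compose_\<Phi>1:
  assumes "(g has_real_derivative g' (\<Phi> p $ 1)) (at (\<Phi> p $ 1))"
  shows "gradient (\<lambda>q. g (\<Phi> q $ 1)) p = g' (\<Phi> p $ 1) *\<^sub>R grad_\<Phi>1 p"
proof (rule gradient_eqI)
  show "((\<lambda>q. g (\<Phi> q $ 1)) has_derivative (\<lambda>h. (g' (\<Phi> p $ 1) *\<^sub>R grad_\<Phi>1 p) \<bullet> h)) (at p)"
    using has_derivative_compose[OF \<Phi>1_has_derivative has_field_derivative_imp_has_derivative[OF assms]] by simp
qed

lemma hessian_compose_\<Phi>1:
  assumes g: "\<And>y. (g has_real_derivative g' y) (at y)" and g': "\<And>y. (g' has_real_derivative g'' y) (at y)"
  shows "hessian (\<lambda>q. g (\<Phi> q $ 1)) p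
    = g'' (\<Phi> p $ 1) *\<^sub>R outer (grad_\<Phi>1 p) (grad_\<Phi>1 p) + g' (\<Phi> p $ 1) *\<^sub>R hess_\<Phi>1 p"
proof (rule hessian_eqI)
  have "((\<lambda>q. g' (\<Phi> q $ 1) *\<^sub>R grad_\<Phi>1 q) has_derivative
      (\<lambda>h. g' (\<Phi> p $ 1) *\<^sub>R (hess_\<Phi>1 p *v h) + (g'' (\<Phi> p $ 1) * (grad_\<Phi>1 p \<bullet> h)) *\<^sub>R grad_\<Phi>1 p)) (at p)"
    by (intro has_derivative_scaleR grad_\<Phi>1_has_derivative
        has_derivative_compose[OF \<Phi>1_has_derivative has_field_derivative_imp_has_derivative[OF g']])
  moreover have "gradient (\<lambda>q. g (\<Phi> q $ 1)) = (\<lambda>q. g' (\<Phi> q $ 1) *\<^sub>R grad_\<Phi>1 q)"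
    using gradient_compose_\<Phi>1[of g g', OF g] by blast
  ultimately show "(gradient (\<lambda>q. g (\<Phi> q $ 1)) has_derivative
      (\<lambda>h. (g'' (\<Phi> p $ 1) *\<^sub>R outer (grad_\<Phi>1 p) (grad_\<Phi>1 p) + g' (\<Phi> p $ 1) *\<^sub>R hess_\<Phi>1 p) *v h)) (at p)"
    by (simp add: matrix_vector_mult_add_rdistrib scaleR_matrix_vector_assoc[symmetric] outer_mult_vector algebra_simps)
qed

lemma trace_mult_outer: "trace (M ** outer a b) = b \<bullet> (M *v a)"
  by (simp add: trace_def outer_def matrix_matrix_mult_def matrix_vector_mult_def inner_vec_def sum_distrib_left mult_ac)

lemma trace_scaleR: "trace (c *\<^sub>R M) = c * trace (M :: mat3)"
  by (simp add: trace_def sum_distrib_left)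

lemma trace_mult_linear:
  fixes M B C :: "real ^ 'n ^ 'n"
  shows "trace (M ** (B + C)) = trace (M ** B) + trace (M ** C)"
    and "trace (M ** (B - C)) = trace (M ** B) - trace (M ** C)"
    and "trace (M ** (c *\<^sub>R B)) = c * trace (M ** B)"
  by (simp_all add: trace_def matrix_matrix_mult_def sum.distrib sum_subtractf sum_distrib_left algebra_simps)

lemma A\<^sub>0_mult_vector: "A\<^sub>0 p *v v = (japanese p)\<^sup>2 *\<^sub>R (v + ((2 + p \<bullet> p) * (p \<bullet> v)) *\<^sub>R p)"
proof -
  have M: "(mat 1 + outer p p) *v v = v + (p \<bullet> v) *\<^sub>R p" for v
    by (simp add: matrix_vector_mult_add_rdistrib outer_mult_vector)
  show ?thesis
    unfolding A\<^sub>0_def scaleR_matrix_vector_assoc[symmetric] matrix_vector_mul_assoc[symmetric] M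
    by (simp add: inner_add_right vec_eq_iff algebra_simps)
qed

lemma trace_outer: "trace (outer p p) = p \<bullet> p"
  by (simp add: trace_def outer_def inner_vec_def)

text \<open>As \<open>A\<^sub>0 = (D\<Phi>)\<^sup>-\<^sup>2\<close>, the matrix \<open>D\<Phi> A\<^sub>0
  D\<Phi>\<close> is the identity, and this is its upper left entry. It makes the coefficient of the second
  velocity derivative equal to one.\<close>
lemma A\<^sub>0_grad_\<Phi>1: "grad_\<Phi>1 p \<bullet> (A\<^sub>0 p *v grad_\<Phi>1 p) = 1"
proof -
  define w where "w = japanese p"
  define r where "r = p $ 1"
  have w: "w > 0" "p \<bullet> p = w\<^sup>2 - 1"
    using japanese_pos[of p] japanese_sq[of p] by (auto simp: w_def)
  have pu: "p \<bullet> grad_\<Phi>1 p = r / w ^ 3"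
    using w(1) by (simp add: grad_\<Phi>1_def inner_diff_right inner_axis w_def[symmetric] r_def[symmetric] w(2))
      (simp add: field_simps eval_nat_numeral)
  have uu: "grad_\<Phi>1 p \<bullet> grad_\<Phi>1 p = 1 / w\<^sup>2 - r\<^sup>2 / w ^ 4 - r\<^sup>2 / w ^ 6"
    using w(1) by (simp add: grad_\<Phi>1_def inner_diff_right inner_diff_left inner_axis inner_axis'
        w_def[symmetric] r_def[symmetric] w(2)) (simp add: field_simps eval_nat_numeral)
  show ?thesis
    unfolding A\<^sub>0_mult_vector inner_scaleR_right inner_add_right inner_commute[of "grad_\<Phi>1 p" p] pu uu w_def[symmetric] w(2)
    using w(1) by (simp add: field_simps eval_nat_numeral)
qed

lemma A\<^sub>0_symmetric: "transpose (A\<^sub>0 p) = A\<^sub>0 p"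
proof -
  have "transpose (mat 1 + outer p p) = mat 1 + outer p p"
    by (simp add: transpose_def outer_def mat_def vec_eq_iff mult.commute)
  then show ?thesis
    by (simp add: A\<^sub>0_def transpose_scalar matrix_transpose_mul)
qed

text \<open>The drift \<open>B\<^sub>0\<close> is chosen for this cancellation: no first-order term survives
  in the velocity variable.\<close>
lemma A\<^sub>0_hess_\<Phi>1: "trace (A\<^sub>0 p ** hess_\<Phi>1 p) + B\<^sub>0 p \<bullet> grad_\<Phi>1 p = 0"
proof -
  define w where "w = japanese p"
  define r where "r = p $ 1"
  have w: "w > 0" "p \<bullet> p = w\<^sup>2 - 1"
    using japanese_pos[of p] japanese_sq[of p] by (auto simp: w_def)
  have "trace (A\<^sub>0 p ** mat 1) = w\<^sup>2 * (3 + (w\<^sup>2 + 1) * (w\<^sup>2 - 1))"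
  proof -
    have "A\<^sub>0 p = w\<^sup>2 *\<^sub>R (mat 1 + (w\<^sup>2 + 1) *\<^sub>R outer p p)"
      unfolding matrix_eq A\<^sub>0_mult_vector using w(2)
      by (simp add: scaleR_matrix_vector_assoc[symmetric] matrix_vector_mult_add_rdistrib outer_mult_vector w_def[symmetric])
    then show ?thesis
      using w(2) by (simp add: trace_scaleR trace_add trace_outer trace_I)
  qed
  then have "trace (A\<^sub>0 p ** hess_\<Phi>1 p) = 3 * r / w ^ 5 * (w\<^sup>2 * ((w\<^sup>2 - 1) + (w\<^sup>2 + 1) * (w\<^sup>2 - 1)\<^sup>2))
      - 1 / w ^ 3 * (2 * (w\<^sup>2 * (r + (w\<^sup>2 + 1) * (w\<^sup>2 - 1) * r)) + r * (w\<^sup>2 * (3 + (w\<^sup>2 + 1) * (w\<^sup>2 - 1))))"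
    unfolding hess_\<Phi>1_def trace_mult_linear trace_mult_outer A\<^sub>0_mult_vector
    by (simp add: w(2) inner_add_right inner_axis inner_axis' divide_inverse power_inverse power2_eq_square
        flip: w_def r_def) (simp add: algebra_simps)
  moreover have "B\<^sub>0 p \<bullet> grad_\<Phi>1 p = (3 * w ^ 4 + 2 * w\<^sup>2) * (r / w ^ 3)"
    using w(1) by (simp add: grad_\<Phi>1_def B\<^sub>0_def inner_diff_right inner_axis w_def[symmetric] r_def[symmetric] w(2))
      (simp add: field_simps eval_nat_numeral)
  ultimately have "trace (A\<^sub>0 p ** hess_\<Phi>1 p) + B\<^sub>0 p \<bullet> grad_\<Phi>1 p
     = 3 * r / w ^ 5 * (w\<^sup>2 * ((w\<^sup>2 - 1) + (w\<^sup>2 + 1) * (w\<^sup>2 - 1)\<^sup>2))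
      - 1 / w ^ 3 * (2 * (w\<^sup>2 * (r + (w\<^sup>2 + 1) * (w\<^sup>2 - 1) * r)) + r * (w\<^sup>2 * (3 + (w\<^sup>2 + 1) * (w\<^sup>2 - 1))))
      + (3 * w ^ 4 + 2 * w\<^sup>2) * (r / w ^ 3)"
    by simp
  also have "\<dots> = 0"
    using w(1) by (simp add: field_simps eval_nat_numeral)
  finally show ?thesis .
qed

text \<open>The quadratic form is \<open>(1 + \<bar>p\<bar>\<^sup>2) (\<bar>\<xi>\<bar>\<^sup>2 + (2 +
  \<bar>p\<bar>\<^sup>2) (p \<bullet> \<xi>)\<^sup>2)\<close>. On the unit ball the first factor is at most
  \<open>2\<close>, and the second at most \<open>(1 + 3) \<bar>\<xi>\<bar>\<^sup>2\<close>.\<close>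
lemma A\<^sub>0_elliptic:
  assumes "p \<in> ball 0 1"
  shows "(norm \<xi>)\<^sup>2 \<le> \<xi> \<bullet> (A\<^sub>0 p *v \<xi>)" "\<xi> \<bullet> (A\<^sub>0 p *v \<xi>) \<le> 8 * (norm \<xi>)\<^sup>2"
proof -
  have p: "0 \<le> p \<bullet> p" "p \<bullet> p \<le> 1"
    using assms power_mono[of "norm p" 1 2] by (simp_all add: power2_norm_eq_inner)
  have eq: "\<xi> \<bullet> (A\<^sub>0 p *v \<xi>) = (1 + p \<bullet> p) * (\<xi> \<bullet> \<xi> + (2 + p \<bullet> p) * (p \<bullet> \<xi>)\<^sup>2)"
    by (simp add: A\<^sub>0_mult_vector japanese_sq inner_add_right inner_commute)
      (simp add: power2_eq_square algebra_simps)
  have cs: "(p \<bullet> \<xi>)\<^sup>2 \<le> \<xi> \<bullet> \<xi>"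
    using Cauchy_Schwarz_ineq[of p \<xi>] mult_right_mono[OF p(2), of "\<xi> \<bullet> \<xi>"] by simp
  have "1 * (\<xi> \<bullet> \<xi>) \<le> (1 + p \<bullet> p) * (\<xi> \<bullet> \<xi> + (2 + p \<bullet> p) * (p \<bullet> \<xi>)\<^sup>2)"
    using p by (intro mult_mono) auto
  then show "(norm \<xi>)\<^sup>2 \<le> \<xi> \<bullet> (A\<^sub>0 p *v \<xi>)"
    by (simp add: eq power2_norm_eq_inner)
  have "(1 + p \<bullet> p) * (\<xi> \<bullet> \<xi> + (2 + p \<bullet> p) * (p \<bullet> \<xi>)\<^sup>2) \<le> 2 * (\<xi> \<bullet> \<xi> + 3 * (\<xi> \<bullet> \<xi>))"
    using p cs by (intro mult_mono add_left_mono) auto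
  then show "\<xi> \<bullet> (A\<^sub>0 p *v \<xi>) \<le> 8 * (norm \<xi>)\<^sup>2"
    by (simp add: eq power2_norm_eq_inner)
qed

section \<open>The solutions of the kinetic equation\<close>

lemma smooth_p1: "smooth (\<lambda>z::phase. snd (snd z) $ 1)"
  by (intro smooth_bounded_linear bounded_linear_compose[OF bounded_linear_vec_nth]
      bounded_linear_compose[OF bounded_linear_snd] bounded_linear_snd)

lemma smooth_norm_sq:
  assumes "bounded_linear L"
  shows "smooth (\<lambda>z. 1 + L z \<bullet> L z)"
  by (intro smooth_add smooth_const smooth_bilinear[OF bounded_bilinear_inner] smooth_bounded_linear assms)

lemma inverse_japanese_eq_powr: "inverse (japanese p) = (1 + p \<bullet> p) powr (- 1 / 2)"
  by (simp add: japanese_def power2_norm_eq_inner powr_minus powr_half_sqrt add_nonneg_nonneg)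

lemma smooth_\<Phi>1: "smooth (\<lambda>z::phase. \<Phi> (snd (snd z)) $ 1)"
proof -
  have "smooth (\<lambda>z::phase. (1 + snd (snd z) \<bullet> snd (snd z)) powr (- 1 / 2) * snd (snd z) $ 1)"
    by (intro smooth_mult smooth_powr smooth_norm_sq smooth_p1 bounded_linear_compose[OF bounded_linear_snd] bounded_linear_snd)
      (simp add: add_pos_nonneg)
  then show ?thesis
    by (simp add: \<Phi>_def inverse_japanese_eq_powr)
qed

lemma smooth_A\<^sub>0: "smooth A\<^sub>0"
proof -
  have outer: "bounded_bilinear outer"
    unfolding bilinear_conv_bounded_bilinear[symmetric] bilinear_def
    by (auto intro!: linearI simp: outer_def vec_eq_iff algebra_simps)
  have mult: "bounded_bilinear ((**) :: mat3 \<Rightarrow> mat3 \<Rightarrow> mat3)"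
    unfolding bilinear_conv_bounded_bilinear[symmetric] bilinear_def
    by (auto intro!: linearI simp: matrix_matrix_mult_def vec_eq_iff sum.distrib sum_distrib_left algebra_simps)
  have "smooth (\<lambda>p. (1 + p \<bullet> p) *\<^sub>R ((mat 1 + outer p p) ** (mat 1 + outer p p)))"
    by (intro smooth_bilinear[OF bounded_bilinear_scaleR] smooth_norm_sq smooth_bilinear[OF mult]
        smooth_add smooth_const smooth_bilinear[OF outer] smooth_bounded_linear bounded_linear_ident)
  then show ?thesis
    unfolding A\<^sub>0_def[abs_def] japanese_sq .
qed

lemma smooth_B\<^sub>0: "smooth B\<^sub>0"
proof -
  have "smooth (\<lambda>p::vec3. (3 * ((1 + p \<bullet> p) * (1 + p \<bullet> p)) + 2 * (1 + p \<bullet> p)) *\<^sub>R p)"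
    by (intro smooth_bilinear[OF bounded_bilinear_scaleR] smooth_norm_sq smooth_mult
        smooth_add smooth_const smooth_bounded_linear bounded_linear_ident)
  moreover have "japanese p ^ 4 = (1 + p \<bullet> p) * (1 + p \<bullet> p)" for p
    unfolding japanese_sq[symmetric] by (simp add: eval_nat_numeral)
  ultimately show ?thesis
    unfolding B\<^sub>0_def[abs_def] japanese_sq by simp
qed

text \<open>At fixed phase \<open>\<theta> = N x\<^sub>1\<close>, this is the real part of
  \<open>e\<^sup>i\<^sup>\<theta>\<close> times the \<open>n\<close>-th derivative of
  \<open>I\<^sub>N\<close>, so the solution is \<open>profile N \<theta> 0\<close> evaluated at the first
  velocity component.\<close>
definition profile :: "real \<Rightarrow> real \<Rightarrow> nat \<Rightarrow> real \<Rightarrow> real" where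
  "profile N \<theta> n \<eta> = cos \<theta> * Re (I_derivative N n \<eta>) - sin \<theta> * Im (I_derivative N n \<eta>)"

lemma f\<^sub>N_eq_profile:
  assumes "N > 0"
  shows "f\<^sub>N N (t, x, p) = profile N (N * x $ 1) 0 (\<Phi> p $ 1)"
  using assms by (simp add: f\<^sub>N_def u\<^sub>N_def I_N_eq_scorer profile_def Re_exp Im_exp)

lemma profile_has_derivative: "(profile N \<theta> n has_real_derivative profile N \<theta> (Suc n) \<eta>) (at \<eta>)"
  unfolding profile_def[abs_def]
  by (intro DERIV_diff DERIV_cmult Re_I_derivative Im_I_derivative)

text \<open>The right-hand side is \<open>\<eta>\<close> times the derivative of the solution in
  \<open>x\<^sub>1\<close>, that is, the transport term.\<close>
lemma profile_ode:
  assumes "N > 0"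
  shows "profile N \<theta> 2 \<eta> + cos \<theta>
    = N * \<eta> * (- sin \<theta> * Re (I_derivative N 0 \<eta>) - cos \<theta> * Im (I_derivative N 0 \<eta>))"
  by (simp add: profile_def I_derivative_ode[OF assms] algebra_simps)

lemma smooth_f\<^sub>N:
  assumes "N > 0"
  shows "smooth (f\<^sub>N N)"
proof -
  have x: "smooth (\<lambda>z::phase. N * fst (snd z) $ 1)"
    by (intro smooth_bounded_linear bounded_linear_compose[OF bounded_linear_mult_right] bounded_linear_compose[OF bounded_linear_vec_nth]
      bounded_linear_compose[OF bounded_linear_fst] bounded_linear_snd)
  \<comment> \<open>The minus sign in front of the sine is absorbed as \<open>cos (\<theta> + \<pi> / 2) = - sin \<theta>\<close>.\<close>
  have "smooth (\<lambda>z::phase. cos (N * fst (snd z) $ 1 + 0) * Re (I_derivative N 0 (\<Phi> (snd (snd z)) $ 1))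
      + cos (N * fst (snd z) $ 1 + pi / 2) * Im (I_derivative N 0 (\<Phi> (snd (snd z)) $ 1)))"
    by (intro smooth_add smooth_mult smooth_cos x
        smooth_compose_real[where S = UNIV and G = "\<lambda>n \<eta>. Re (I_derivative N n \<eta>)", OF Re_I_derivative smooth_\<Phi>1]
        smooth_compose_real[where S = UNIV and G = "\<lambda>n \<eta>. Im (I_derivative N n \<eta>)", OF Im_I_derivative smooth_\<Phi>1]) auto
  moreover have "(\<lambda>z::phase. cos (N * fst (snd z) $ 1 + 0) * Re (I_derivative N 0 (\<Phi> (snd (snd z)) $ 1))
      + cos (N * fst (snd z) $ 1 + pi / 2) * Im (I_derivative N 0 (\<Phi> (snd (snd z)) $ 1))) = f\<^sub>N N"
    by (simp add: fun_eq_iff f\<^sub>N_eq_profile[OF assms] profile_def cos_add)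
  ultimately show ?thesis by simp
qed

lemma hess_p_f\<^sub>N:
  assumes "N > 0"
  shows "hess_p (f\<^sub>N N) (t, x, p)
    = profile N (N * x $ 1) 2 (\<Phi> p $ 1) *\<^sub>R outer (grad_\<Phi>1 p) (grad_\<Phi>1 p)
      + profile N (N * x $ 1) 1 (\<Phi> p $ 1) *\<^sub>R hess_\<Phi>1 p"
  unfolding hess_p_def prod.case f\<^sub>N_eq_profile[OF assms] numeral_2_eq_2 One_nat_def
  by (rule hessian_compose_\<Phi>1[where g' = "profile N (N * x $ 1) (Suc 0)"]; rule profile_has_derivative)

lemma gradient_x_f\<^sub>N:
  assumes "N > 0"
  shows "gradient (\<lambda>y. f\<^sub>N N (t, y, p)) x
    = (N * (- sin (N * x $ 1) * Re (I_derivative N 0 (\<Phi> p $ 1))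
        - cos (N * x $ 1) * Im (I_derivative N 0 (\<Phi> p $ 1)))) *\<^sub>R axis 1 1"
proof (rule gradient_eqI)
  let ?c = "Re (I_derivative N 0 (\<Phi> p $ 1))" and ?s = "Im (I_derivative N 0 (\<Phi> p $ 1))"
  have 1: "((\<lambda>y::vec3. y $ 1) has_derivative (\<lambda>h. h $ 1)) (at x)"
    by (rule bounded_linear_imp_has_derivative[OF bounded_linear_vec_nth])
  have "((\<lambda>r. cos (N * r) * ?c - sin (N * r) * ?s) has_real_derivative
      N * (- sin (N * x $ 1) * ?c - cos (N * x $ 1) * ?s)) (at (x $ 1))"
    by (auto intro!: derivative_eq_intros simp: algebra_simps)
  from has_derivative_compose[OF 1 has_field_derivative_imp_has_derivative[OF this]]
  show "((\<lambda>y. f\<^sub>N N (t, y, p)) has_derivative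
      (\<lambda>h. ((N * (- sin (N * x $ 1) * ?c - cos (N * x $ 1) * ?s)) *\<^sub>R axis 1 1) \<bullet> h)) (at x)"
    by (simp add: f\<^sub>N_eq_profile[OF assms] profile_def inner_axis')
qed

text \<open>The condition on \<open>D\<close> makes the one-sided time derivative well defined. It holds for
  the whole space and for the half-open cylinder, and the derivative of a stationary function is then
  zero.\<close>
lemma f\<^sub>N_solves_on:
  assumes "N > 0" and D: "\<And>t x p. (t, x, p) \<in> D \<Longrightarrow> at t within {\<tau>. (\<tau>, x, p) \<in> D} \<noteq> bot"
  shows "solves_on D A\<^sub>0 B\<^sub>0 (f\<^sub>N N) (s\<^sub>N N)"
  unfolding solves_on_def
proof (clarify, goal_cases)
  case (1 t x p)
  let ?\<theta> = "N * x $ 1" and ?\<eta> = "\<Phi> p $ 1"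
  have stationary: "vector_derivative (\<lambda>\<tau>. f\<^sub>N N (\<tau>, x, p)) (at t within {\<tau>. (\<tau>, x, p) \<in> D}) = 0"
    by (rule vector_derivative_within[OF D[OF 1]]) (simp add: f\<^sub>N_def)
  have grad: "gradient (\<lambda>q. f\<^sub>N N (t, x, q)) p = profile N ?\<theta> 1 ?\<eta> *\<^sub>R grad_\<Phi>1 p"
    unfolding f\<^sub>N_eq_profile[OF assms(1)]
    by (rule gradient_compose_\<Phi>1) (simp add: profile_has_derivative)
  have "trace (A\<^sub>0 p ** hess_p (f\<^sub>N N) (t, x, p)) + B\<^sub>0 p \<bullet> gradient (\<lambda>q. f\<^sub>N N (t, x, q)) p
      = profile N ?\<theta> 2 ?\<eta> * 1 + profile N ?\<theta> 1 ?\<eta> * (trace (A\<^sub>0 p ** hess_\<Phi>1 p) + B\<^sub>0 p \<bullet> grad_\<Phi>1 p)"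
    unfolding grad hess_p_f\<^sub>N[OF assms(1)] trace_mult_linear trace_mult_outer A\<^sub>0_grad_\<Phi>1
    by (simp add: algebra_simps)
  also have "\<dots> = profile N ?\<theta> 2 ?\<eta>"
    by (simp add: A\<^sub>0_hess_\<Phi>1)
  finally show ?case
    using profile_ode[OF assms(1), of ?\<theta> ?\<eta>]
    unfolding stationary gradient_x_f\<^sub>N[OF assms(1)]
    by (simp add: s\<^sub>N_def inner_axis mult_ac)
qed

section \<open>Bounds that are uniform along the family\<close>

lemma Linf_norm_le:
  fixes h :: "'a::euclidean_space \<Rightarrow> 'b::real_normed_vector"
  assumes "continuous_on S h" "S \<in> sets borel" "\<And>z. z \<in> S \<Longrightarrow> norm (h z) \<le> C"
  shows "Linf_norm S h \<le> ennreal C"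
  unfolding Linf_norm_def
proof (rule esssup_I)
  have "continuous_on S (\<lambda>z. norm (h z))"
    using assms(1) by (intro continuous_intros)
  then have "(\<lambda>z. norm (h z)) \<in> borel_measurable (lebesgue_on S)"
    using assms(2) by (intro continuous_imp_measurable_on_sets_lebesgue) auto
  then show "(\<lambda>z. ennreal (norm (h z))) \<in> borel_measurable (lebesgue_on S)"
    by measurable
  show "AE z in lebesgue_on S. ennreal (norm (h z)) \<le> ennreal C"
    using assms(3) by (intro AE_I2) (auto intro: ennreal_leI)
qed

lemma cyl_borel: "cyl r \<in> sets borel"
  unfolding cyl_def borel_prod[symmetric] by (intro pair_measureI) auto

lemma Linf_norm_f\<^sub>N_le: "\<exists>C>0. \<forall>N>0. Linf_norm (cyl 1) (f\<^sub>N N) \<le> ennreal (C * N powr (- 2 / 3))"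
proof -
  obtain C where C: "C > 0" "\<And>N \<eta>. N > 0 \<Longrightarrow> cmod (I\<^sub>N N \<eta>) \<le> C * N powr (- 2 / 3)"
    using cmod_I_N_le by blast
  have "norm (f\<^sub>N N z) \<le> C * N powr (- 2 / 3)" if "N > 0" for N z
  proof -
    obtain t x p where z: "z = (t, x, p)" by (cases z)
    have "norm (f\<^sub>N N z) \<le> cmod (exp (\<i> * complex_of_real (N * x $ 1)) * I\<^sub>N N (\<Phi> p $ 1))"
      unfolding z f\<^sub>N_def u\<^sub>N_def prod.case real_norm_def by (rule abs_Re_le_cmod)
    also have "\<dots> = cmod (I\<^sub>N N (\<Phi> p $ 1))"
      by (simp add: norm_mult)
    finally show ?thesis using C(2)[OF that, of "\<Phi> p $ 1"] by linarith
  qed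
  then show ?thesis
    using C(1) smooth_imp_continuous[OF smooth_f\<^sub>N] by (blast intro: Linf_norm_le cyl_borel)
qed

lemma holder_semi_s\<^sub>N: "holder_semi \<alpha> Q (s\<^sub>N N) = 0"
proof -
  have "holder_semi \<alpha> Q (s\<^sub>N N) \<le> 0"
    unfolding holder_semi_def by (rule Sup_least) (auto simp: s\<^sub>N_def)
  then show ?thesis by simp
qed

lemma holder_norm_s\<^sub>N_le: "holder_norm \<beta> (cyl 1) (s\<^sub>N N) \<le> 1"
proof -
  have "continuous_on (cyl 1) (s\<^sub>N N)"
    unfolding s\<^sub>N_def case_prod_beta by (intro continuous_intros)
  then have "Linf_norm (cyl 1) (s\<^sub>N N) \<le> ennreal 1"
    by (rule Linf_norm_le[OF _ cyl_borel]) (auto simp: s\<^sub>N_def)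
  then show ?thesis
    by (simp add: holder_norm_def holder_semi_s\<^sub>N)
qed

text \<open>A smooth function is Lipschitz on the closed ball, and \<open>r \<le> r\<^sup>\<beta>\<close>
  for distances below one.\<close>
lemma smooth_holder_norm_mom_finite:
  fixes h :: "vec3 \<Rightarrow> 'b::real_normed_vector"
  assumes h: "smooth h" and \<beta>: "0 < \<beta>" "\<beta> < 1"
  shows "holder_norm_mom \<beta> (ball 0 1) h < \<infinity>"
proof -
  have "bounded (h ` cball 0 1)"
    by (intro compact_imp_bounded compact_continuous_image smooth_imp_continuous h) auto
  then obtain M where M: "\<And>p. p \<in> cball 0 1 \<Longrightarrow> norm (h p) \<le> M"
    unfolding bounded_iff by blast
  have "Linf_norm (ball 0 1) h \<le> ennreal M"
    by (rule Linf_norm_le[OF smooth_imp_continuous[OF h]]) (use M in auto)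
  moreover obtain L where L: "L \<ge> 0" "\<And>p p'. p \<in> cball 0 1 \<Longrightarrow> p' \<in> cball 0 1 \<Longrightarrow> norm (h p - h p') \<le> L * norm (p - p')"
    using smooth_lipschitz_on_compact[OF h, of "cball 0 1"] by auto
  have "holder_semi_mom \<beta> (ball 0 1) h \<le> ennreal L"
    unfolding holder_semi_mom_def
  proof (rule Sup_least, clarify)
    fix p p' :: vec3
    assume p: "p \<in> ball 0 1" "p' \<in> ball 0 1" "0 < norm (p - p')" "norm (p - p') < 1 / 2"
    have "norm (p - p') powr 1 \<le> norm (p - p') powr \<beta>"
      using p \<beta> by (intro powr_mono') auto
    then have "norm (p - p') \<le> norm (p - p') powr \<beta>"
      using p by simp
    have "norm (h p - h p') \<le> L * norm (p - p')"
      using p by (intro L(2)) auto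
    also have "\<dots> \<le> L * norm (p - p') powr \<beta>"
      using L(1) \<open>norm (p - p') \<le> _\<close> by (rule mult_left_mono[rotated])
    finally show "ennreal (norm (h p - h p') / norm (p - p') powr \<beta>) \<le> ennreal L"
      using p by (intro ennreal_leI) (simp add: divide_le_eq)
  qed
  ultimately show ?thesis
    unfolding holder_norm_mom_def
    by (metis ennreal_add_less_top ennreal_less_top infinity_ennreal_def order_le_less_trans)
qed

section \<open>Growth of the Hessian seminorm\<close>

lemma I_derivative_1_2:
  assumes "N > 0"
  shows "I_derivative N 1 \<eta> = of_real (N powr (- 1 / 3)) * scorer 1 (N powr (1 / 3) * \<eta>)"
    and "I_derivative N 2 \<eta> = scorer 2 (N powr (1 / 3) * \<eta>)"
proof -
  have "N powr (1 / 3) * N powr (- 2 / 3) = N powr (- 1 / 3)"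
    and m: "(N powr (1 / 3))\<^sup>2 * N powr (- 2 / 3) = 1"
    using assms by (simp_all add: powr_power flip: powr_add)
  then show "I_derivative N 1 \<eta> = of_real (N powr (- 1 / 3)) * scorer 1 (N powr (1 / 3) * \<eta>)"
    by (simp add: I_derivative_def flip: of_real_mult)
  show "I_derivative N 2 \<eta> = scorer 2 (N powr (1 / 3) * \<eta>)"
    unfolding I_derivative_def m by simp
qed

lemma norm_axis_eq_abs: "norm (axis i q :: real ^ 'n) = \<bar>q\<bar>"
  by (simp add: norm_eq_sqrt_inner inner_axis_axis)

text \<open>On the first axis the point \<open>\<eta> / v\<close> with \<open>v = (1 -
  \<eta>\<^sup>2)\<^sup>1\<^sup>/\<^sup>2\<close> is the momentum of velocity \<open>\<eta>\<close>, and
  \<open>v\<close> is its inverse Lorentz factor.\<close>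
lemma \<Phi>1_axis:
  fixes \<eta> :: real
  assumes "\<bar>\<eta>\<bar> < 1"
  defines "v \<equiv> sqrt (1 - \<eta>\<^sup>2)"
  shows "inverse (japanese (axis 1 (\<eta> / v))) = v" "\<Phi> (axis 1 (\<eta> / v)) $ 1 = \<eta>"
    and "grad_\<Phi>1 (axis 1 (\<eta> / v)) $ 1 = v ^ 3"
    and "hess_\<Phi>1 (axis 1 (\<eta> / v)) $ 1 $ 1 = - 3 * \<eta> * v ^ 4"
proof -
  have "\<eta>\<^sup>2 < 1"
    using assms(1) by (simp add: abs_square_less_1)
  then have v: "v > 0" "v\<^sup>2 = 1 - \<eta>\<^sup>2"
    by (simp_all add: v_def)
  then have "v\<^sup>2 + \<eta>\<^sup>2 = 1"
    by simp
  have *: "1 + (\<eta> / v)\<^sup>2 = (inverse v)\<^sup>2"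
    using v \<open>v\<^sup>2 + \<eta>\<^sup>2 = 1\<close> by (simp add: power_divide field_simps)
  have "japanese (axis 1 (\<eta> / v)) = inverse v"
    unfolding japanese_def norm_axis_eq_abs power2_abs *
    by (rule real_sqrt_unique) (use v(1) in simp_all)
  then show 1: "inverse (japanese (axis 1 (\<eta> / v))) = v"
    by simp
  show "\<Phi> (axis 1 (\<eta> / v)) $ 1 = \<eta>"
    using v(1) unfolding \<Phi>_def by (simp add: 1)
  have "grad_\<Phi>1 (axis 1 (\<eta> / v)) $ 1 = v * (1 - \<eta>\<^sup>2)"
    using v(1) by (simp add: grad_\<Phi>1_def 1) (simp add: field_simps eval_nat_numeral)
  then show "grad_\<Phi>1 (axis 1 (\<eta> / v)) $ 1 = v ^ 3"
    by (simp add: v(2)[symmetric]) (simp add: eval_nat_numeral)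
  have "hess_\<Phi>1 (axis 1 (\<eta> / v)) $ 1 $ 1 = 3 * \<eta> * v\<^sup>2 * (\<eta>\<^sup>2 - 1)"
    using v(1) by (simp add: hess_\<Phi>1_def 1 outer_def mat_def) (simp add: field_simps eval_nat_numeral)
  also have "\<eta>\<^sup>2 - 1 = - v\<^sup>2"
    by (simp add: v(2))
  finally show "hess_\<Phi>1 (axis 1 (\<eta> / v)) $ 1 $ 1 = - 3 * \<eta> * v ^ 4"
    by (simp add: eval_nat_numeral)
qed

text \<open>At \<open>N\<^sup>1\<^sup>/\<^sup>3 \<eta> = a\<close> the model integrals are evaluated at the
  fixed argument \<open>a\<close>, so the entry is a fixed even polynomial in the small velocity
  \<open>\<eta>\<close>. The \<open>N\<^sup>-\<^sup>1\<^sup>/\<^sup>3\<close> in front of the first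
  derivative becomes \<open>\<eta> / a\<close>.\<close>
lemma hess_p_f\<^sub>N_axis:
  assumes "N > 0" "a > 0" "a * N powr (- 1 / 3) < 1"
  defines "\<eta> \<equiv> a * N powr (- 1 / 3)"
  shows "hess_p (f\<^sub>N N) (0, 0, axis 1 (\<eta> / sqrt (1 - \<eta>\<^sup>2))) $ 1 $ 1
    = Re (scorer 2 a) * (1 - \<eta>\<^sup>2) ^ 3 - 3 * Re (scorer 1 a) / a * \<eta>\<^sup>2 * (1 - \<eta>\<^sup>2)\<^sup>2"
proof -
  define v where "v = sqrt (1 - \<eta>\<^sup>2)"
  have \<eta>: "0 < \<eta>" "\<eta> < 1"
    using assms by (simp_all add: \<eta>_def)
  have "\<eta>\<^sup>2 < 1"
    using \<eta> by (simp add: abs_square_less_1)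
  then have v: "v\<^sup>2 = 1 - \<eta>\<^sup>2"
    by (simp add: v_def)
  have scale: "N powr (1 / 3) * \<eta> = a"
    using assms by (simp add: \<eta>_def flip: powr_add)
  have N: "N powr - (1 / 3) = \<eta> / a"
    using assms by (simp add: \<eta>_def)
  have "hess_p (f\<^sub>N N) (0, 0, axis 1 (\<eta> / v)) $ 1 $ 1
      = Re (scorer 2 a) * (v ^ 3)\<^sup>2 + \<eta> / a * Re (scorer 1 a) * (- 3 * \<eta> * v ^ 4)"
    using \<eta> \<Phi>1_axis[of \<eta>, folded v_def]
    by (simp add: hess_p_f\<^sub>N[OF assms(1)] profile_def I_derivative_1_2[OF assms(1)] scale N outer_def power2_eq_square
        del: One_nat_def)
  also have "\<dots> = Re (scorer 2 a) * (v\<^sup>2) ^ 3 - 3 * Re (scorer 1 a) / a * \<eta>\<^sup>2 * (v\<^sup>2)\<^sup>2"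
    by (simp add: eval_nat_numeral)
  finally show ?thesis
    unfolding v unfolding v_def .
qed

lemma axis_zero: "axis i 0 = (0 :: real ^ 'n)"
  by (simp add: axis_def vec_eq_iff)

lemma hess_p_f\<^sub>N_0:
  assumes "N > 0"
  shows "hess_p (f\<^sub>N N) (0, 0, 0) $ 1 $ 1 = - 1"
  using \<Phi>1_axis[of 0]
  by (simp add: axis_zero hess_p_f\<^sub>N[OF assms] profile_def I_derivative_1_2[OF assms] scorer_ode outer_def del: One_nat_def)

lemma norm_matrix_entry_le: "\<bar>M $ i $ j\<bar> \<le> norm (M :: real ^ 'n ^ 'm)"
  using component_le_norm_cart[of "M $ i" j] Finite_Cartesian_Product.norm_nth_le[of M i] by simp

text \<open>The increment of the upper left Hessian entry between \<open>p = 0\<close> and velocity \<open>a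
  N\<^sup>-\<^sup>1\<^sup>/\<^sup>3\<close> is a polynomial \<open>E\<close> in that velocity with \<open>E
  0 = - a Im (J a) \<noteq> 0\<close>, where \<open>J\<close> is \<open>scorer 0\<close>. It stays away from
  zero while the distance of the two momenta shrinks like
  \<open>N\<^sup>-\<^sup>1\<^sup>/\<^sup>3\<close>.\<close>
lemma holder_semi_hess_f\<^sub>N_ge:
  assumes "\<alpha> > 0"
  shows "\<exists>c N\<^sub>0. c > 0 \<and> N\<^sub>0 \<ge> 1 \<and>
    (\<forall>N\<ge>N\<^sub>0. ennreal (c * N powr (\<alpha> / 3)) \<le> holder_semi \<alpha> (cyl (1 / 2)) (hess_p (f\<^sub>N N)))"
proof -
  obtain a where a: "a > 0" "Im (scorer 0 a) \<noteq> 0"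
    using Im_scorer_nonzero by blast
  define \<delta> where "\<delta> = a * \<bar>Im (scorer 0 a)\<bar>"
  have \<delta>: "\<delta> > 0"
    using a by (simp add: \<delta>_def)
  define \<eta> where "\<eta> = (\<lambda>N::real. a * N powr (- 1 / 3))"
  define E where "E = (\<lambda>y. Re (scorer 2 a) * (1 - y\<^sup>2) ^ 3 - 3 * Re (scorer 1 a) / a * y\<^sup>2 * (1 - y\<^sup>2)\<^sup>2 + 1)"
  have lim: "(\<eta> \<longlongrightarrow> 0) at_top"
    unfolding \<eta>_def by real_asymp
  have "isCont (\<lambda>y. \<bar>E y\<bar>) 0"
    unfolding E_def using a by (intro continuous_intros) auto
  moreover have "\<bar>E 0\<bar> = \<delta>"
    using a by (simp add: E_def scorer_ode \<delta>_def abs_mult)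
  ultimately have "((\<lambda>N. \<bar>E (\<eta> N)\<bar>) \<longlongrightarrow> \<delta>) at_top"
    using isCont_tendsto_compose[OF _ lim, of "\<lambda>y. \<bar>E y\<bar>"] by simp
  then have "eventually (\<lambda>N. \<bar>E (\<eta> N)\<bar> > \<delta> / 2) at_top"
    by (rule order_tendstoD) (use \<delta> in simp)
  moreover have "eventually (\<lambda>N. \<eta> N < 1 / 4) at_top"
    by (rule order_tendstoD(2)[OF lim]) simp
  ultimately have "eventually (\<lambda>N. \<bar>E (\<eta> N)\<bar> > \<delta> / 2 \<and> \<eta> N < 1 / 4) at_top"
    by eventually_elim simp
  then obtain N1 where N1: "\<And>N. N \<ge> N1 \<Longrightarrow> \<bar>E (\<eta> N)\<bar> > \<delta> / 2 \<and> \<eta> N < 1 / 4"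
    unfolding eventually_at_top_linorder by blast
  define c where "c = \<delta> / 2 / (2 * a) powr \<alpha>"
  have "ennreal (c * N powr (\<alpha> / 3)) \<le> holder_semi \<alpha> (cyl (1 / 2)) (hess_p (f\<^sub>N N))" if N: "N \<ge> max 1 N1" for N
  proof -
    have N': "N > 0" "\<bar>E (\<eta> N)\<bar> > \<delta> / 2" "\<eta> N < 1 / 4" "\<eta> N > 0"
      using N N1[of N] a by (auto simp: \<eta>_def)
    define q where "q = \<eta> N / sqrt (1 - (\<eta> N)\<^sup>2)"
    have q: "0 < q" "q \<le> 2 * \<eta> N"
    proof -
      have "(\<eta> N)\<^sup>2 \<le> (1 / 4)\<^sup>2"
        using N' by (intro power_mono) auto
      then have lt: "(\<eta> N)\<^sup>2 < 1" and "(1 / 2)\<^sup>2 \<le> 1 - (\<eta> N)\<^sup>2"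
        by (auto simp: power2_eq_square)
      \<comment> \<open>Velocities below \<open>1 / 4\<close> keep the momentum in the ball of radius \<open>1 / 2\<close> and at most twice the velocity.\<close>
      then have s: "1 / 2 \<le> sqrt (1 - (\<eta> N)\<^sup>2)"
        by (intro real_le_rsqrt)
      then have "q \<le> \<eta> N / (1 / 2)"
        unfolding q_def using N' s lt by (intro divide_left_mono) auto
      then show "q \<le> 2 * \<eta> N"
        by simp
      show "0 < q"
        unfolding q_def using lt by (intro divide_pos_pos N') simp
    qed
    define p where "p = (axis 1 q :: vec3)"
    have p: "norm p = q"
      using q by (simp add: p_def norm_axis_eq_abs)
    have "\<delta> / 2 \<le> \<bar>E (\<eta> N)\<bar>"
      using N' by simp
    also have "E (\<eta> N) = (hess_p (f\<^sub>N N) (0, 0, p) - hess_p (f\<^sub>N N) (0, 0, 0)) $ 1 $ 1"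
      using hess_p_f\<^sub>N_axis[of N a] hess_p_f\<^sub>N_0[of N] N' a
      by (simp add: E_def p_def q_def \<eta>_def)
    also have "\<bar>\<dots>\<bar> \<le> norm (hess_p (f\<^sub>N N) (0, 0, p) - hess_p (f\<^sub>N N) (0, 0, 0))"
      by (rule norm_matrix_entry_le)
    finally have num: "\<delta> / 2 \<le> norm (hess_p (f\<^sub>N N) (0, 0, p) - hess_p (f\<^sub>N N) (0, 0, 0))" .
    have "q powr \<alpha> \<le> (2 * \<eta> N) powr \<alpha>"
      using q assms by (intro powr_mono2) auto
    also have "\<dots> = (2 * a) powr \<alpha> * N powr (- (\<alpha> / 3))"
      using a N' by (simp add: \<eta>_def powr_mult powr_powr mult.assoc[symmetric])
    finally have den: "q powr \<alpha> \<le> (2 * a) powr \<alpha> * N powr (- (\<alpha> / 3))" .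
    have "c * N powr (\<alpha> / 3) = (\<delta> / 2) / ((2 * a) powr \<alpha> * N powr (- (\<alpha> / 3)))"
      unfolding c_def powr_minus_divide by simp
    also have "\<dots> \<le> norm (hess_p (f\<^sub>N N) (0, 0, p) - hess_p (f\<^sub>N N) (0, 0, 0)) / q powr \<alpha>"
      using num den q \<delta> by (intro frac_le) auto
    finally have "ennreal (c * N powr (\<alpha> / 3))
        \<le> ennreal (norm (hess_p (f\<^sub>N N) (0, 0, p) - hess_p (f\<^sub>N N) (0, 0, 0)) / norm (p - 0) powr \<alpha>)"
      by (intro ennreal_leI) (simp add: p)
    also have "\<dots> \<le> holder_semi \<alpha> (cyl (1 / 2)) (hess_p (f\<^sub>N N))"
      unfolding holder_semi_def
    proof (rule Sup_upper, clarify, intro exI conjI)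
      show "(0, 0, p) \<in> cyl (1 / 2)" "(0, 0, 0) \<in> cyl (1 / 2)" "0 < norm (p - 0)" "norm (p - 0) < 1 / 2"
        using q N' by (auto simp: cyl_def p)
    qed (rule refl)
    finally show ?thesis .
  qed
  moreover have "c > 0"
    using \<delta> a by (simp add: c_def)
  ultimately show ?thesis
    by (intro exI[of _ c] exI[of _ "max 1 N1"]) auto
qed

section \<open>Failure of the estimates\<close>

lemma holder_semi_hess_f\<^sub>N_unbounded:
  assumes "\<alpha> > 0"
  shows "\<exists>N\<ge>1. ennreal M < holder_semi \<alpha> (cyl (1 / 2)) (hess_p (f\<^sub>N N))"
proof -
  obtain c N\<^sub>0 where c: "c > 0" and N\<^sub>0: "N\<^sub>0 \<ge> 1"
    and low: "\<And>N. N \<ge> N\<^sub>0 \<Longrightarrow> ennreal (c * N powr (\<alpha> / 3)) \<le> holder_semi \<alpha> (cyl (1 / 2)) (hess_p (f\<^sub>N N))"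
    using holder_semi_hess_f\<^sub>N_ge[OF assms] by blast
  have "filterlim (\<lambda>N. c * N powr (\<alpha> / 3)) at_top at_top"
    using assms c by real_asymp
  then have "eventually (\<lambda>N. c * N powr (\<alpha> / 3) > max M 0) at_top"
    by (simp only: filterlim_at_top_dense)
  then have "eventually (\<lambda>N. N \<ge> N\<^sub>0 \<and> c * N powr (\<alpha> / 3) > max M 0) at_top"
    using eventually_ge_at_top[of N\<^sub>0] by eventually_elim simp
  then obtain N where N: "N \<ge> N\<^sub>0" "c * N powr (\<alpha> / 3) > max M 0"
    using eventually_happens'[OF trivial_limit_at_top_linorder] by blast
  have "ennreal M \<le> ennreal (max M 0)"
    by (intro ennreal_leI) simp
  also have "\<dots> < ennreal (c * N powr (\<alpha> / 3))"
    using N(2) by (intro ennreal_lessI) auto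
  also have "\<dots> \<le> holder_semi \<alpha> (cyl (1 / 2)) (hess_p (f\<^sub>N N))"
    by (rule low[OF N(1)])
  finally show ?thesis
    using N(1) N\<^sub>0 by (intro exI[of _ N]) auto
qed

text \<open>The cylinder contains an interval of earlier times before each of its points, the final time
  included.\<close>
lemma at_within_cyl_time: "(t, x, p) \<in> cyl 1 \<Longrightarrow> at t within {\<tau>. (\<tau>, x, p) \<in> cyl 1} \<noteq> bot"
proof -
  assume "(t, x, p) \<in> cyl 1"
  then have t: "-1 < t" "t \<le> 0" and sub: "{(t - 1) / 2..t} \<subseteq> {\<tau>. (\<tau>, x, p) \<in> cyl 1}"
    by (auto simp: cyl_def)
  \<comment> \<open>The midpoint of \<open>-1\<close> and \<open>t\<close> is a time inside the cylinder before \<open>t\<close>.\<close>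
  have "t islimpt {(t - 1) / 2..t}"
    using t by (subst islimpt_Icc) auto
  then show ?thesis
    using islimpt_subset[OF _ sub] by (simp add: trivial_limit_within)
qed

lemma f\<^sub>N_solves_on_cyl: "N > 0 \<Longrightarrow> solves_on (cyl 1) A\<^sub>0 B\<^sub>0 (f\<^sub>N N) (s\<^sub>N N)"
  by (intro f\<^sub>N_solves_on at_within_cyl_time)

lemma Linf_norm_f\<^sub>N_bounded: "\<exists>C>0. \<forall>N\<ge>1. Linf_norm (cyl 1) (f\<^sub>N N) \<le> ennreal C"
proof -
  obtain C where C: "C > 0" "\<And>N. N > 0 \<Longrightarrow> Linf_norm (cyl 1) (f\<^sub>N N) \<le> ennreal (C * N powr (- 2 / 3))"
    using Linf_norm_f\<^sub>N_le by blast
  have "Linf_norm (cyl 1) (f\<^sub>N N) \<le> ennreal C" if "N \<ge> 1" for N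
  proof -
    have "N powr (- 2 / 3) \<le> N powr 0"
      using that by (intro powr_mono) auto
    then have "C * N powr (- 2 / 3) \<le> C"
      using C(1) that by simp
    then show ?thesis
      using C(2)[of N] that by (meson ennreal_leI order_trans less_le_trans zero_less_one)
  qed
  then show ?thesis using C(1) by blast
qed

lemma not_linear_schauder:
  assumes "\<alpha> > 0"
  shows "\<not> linear_schauder A\<^sub>0 B\<^sub>0 \<alpha> C"
proof
  assume est: "linear_schauder A\<^sub>0 B\<^sub>0 \<alpha> C"
  obtain K where K: "\<And>N. N \<ge> 1 \<Longrightarrow> Linf_norm (cyl 1) (f\<^sub>N N) \<le> ennreal K" "K > 0"
    using Linf_norm_f\<^sub>N_bounded by blast
  obtain N where N: "N \<ge> 1" "ennreal (C * K) < holder_semi \<alpha> (cyl (1 / 2)) (hess_p (f\<^sub>N N))"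
    using holder_semi_hess_f\<^sub>N_unbounded[OF assms] by blast
  have "N > 0" using N(1) by simp
  have "holder_semi \<alpha> (cyl (1 / 2)) (hess_p (f\<^sub>N N))
      \<le> ennreal C * (Linf_norm (cyl 1) (f\<^sub>N N) + holder_semi \<alpha> (cyl 1) (s\<^sub>N N))"
    using est smooth_imp_smooth_on[OF smooth_f\<^sub>N] f\<^sub>N_solves_on_cyl \<open>N > 0\<close>
    unfolding linear_schauder_def by blast
  also have "\<dots> \<le> ennreal C * ennreal K"
    using K(1)[OF N(1)] by (simp add: holder_semi_s\<^sub>N mult_left_mono)
  also have "\<dots> = ennreal (C * K)"
    using K(2) by (simp add: ennreal_mult'')
  finally show False
    using N(2) by simp
qed

text \<open>The four arguments of \<open>F\<close> stay in a fixed box along the family, on which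
  \<open>F\<close> is bounded.\<close>
lemma not_general_schauder:
  assumes \<alpha>: "\<alpha> > 0" and \<beta>: "0 < \<beta>" "\<beta> < 1" and K: "(A\<^sub>0, B\<^sub>0) \<in> K" and F: "bounded_on_bounded F"
  shows "\<not> general_schauder K \<alpha> \<beta> F"
proof
  assume est: "general_schauder K \<alpha> \<beta> F"
  obtain C where C: "\<And>N. N \<ge> 1 \<Longrightarrow> Linf_norm (cyl 1) (f\<^sub>N N) \<le> ennreal C" "C > 0"
    using Linf_norm_f\<^sub>N_bounded by blast
  define a where "a = enn2real (holder_norm_mom \<beta> (ball 0 1) A\<^sub>0)"
  define b where "b = enn2real (holder_norm_mom \<beta> (ball 0 1) B\<^sub>0)"
  define S where "S = {0..C} \<times> {0..1::real} \<times> {a} \<times> {b}"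
  have "S \<subseteq> orthant" "bounded S"
    unfolding S_def orthant_def a_def b_def by (auto intro!: bounded_Times)
  then have "bounded (F ` S)"
    using F by (simp add: bounded_on_bounded_def)
  then obtain M where M: "\<And>y. y \<in> S \<Longrightarrow> F y \<le> M"
    unfolding bounded_iff by (metis abs_le_D1 imageI real_norm_def)
  obtain N where N: "N \<ge> 1" "ennreal M < holder_semi \<alpha> (cyl (1 / 2)) (hess_p (f\<^sub>N N))"
    using holder_semi_hess_f\<^sub>N_unbounded[OF \<alpha>] by blast
  have "N > 0" using N(1) by simp
  let ?l = "Linf_norm (cyl 1) (f\<^sub>N N)" and ?s = "holder_norm \<beta> (cyl 1) (s\<^sub>N N)"
  have fin: "?l < \<infinity>" "?s < \<infinity>"
    by (rule order_le_less_trans[OF C(1)[OF N(1)]], simp)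
      (rule order_le_less_trans[OF holder_norm_s\<^sub>N_le], simp)
  have "holder_semi \<alpha> (cyl (1 / 2)) (hess_p (f\<^sub>N N)) \<le> ennreal (F (enn2real ?l, enn2real ?s, a, b))"
    using est K fin smooth_imp_smooth_on[OF smooth_f\<^sub>N] f\<^sub>N_solves_on_cyl \<open>N > 0\<close>
      smooth_holder_norm_mom_finite[OF smooth_A\<^sub>0 \<beta>] smooth_holder_norm_mom_finite[OF smooth_B\<^sub>0 \<beta>]
    unfolding general_schauder_def a_def b_def by blast
  also have "\<dots> \<le> ennreal M"
  proof (intro ennreal_leI M)
    have "enn2real ?l \<le> C"
      using C(1)[OF N(1)] C(2) by (intro enn2real_leI) auto
    moreover have "enn2real ?s \<le> 1"
      using holder_norm_s\<^sub>N_le[of \<beta> N] by (intro enn2real_leI) auto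
    ultimately show "(enn2real ?l, enn2real ?s, a, b) \<in> S"
      by (simp add: S_def)
  qed
  finally show False
    using N(2) by simp
qed

theorem theorem3p1:
  shows "smooth_on UNIV A\<^sub>0 \<and> smooth_on UNIV B\<^sub>0 \<and>
    (\<forall>N\<ge>1. smooth_on UNIV (f\<^sub>N N) \<and>
       (\<forall>t t' x p. f\<^sub>N N (t, x, p) = f\<^sub>N N (t', x, p)) \<and>
       solves_on UNIV A\<^sub>0 B\<^sub>0 (f\<^sub>N N) (s\<^sub>N N)) \<and>
    (\<forall>\<alpha>. 0 < \<alpha> \<and> \<alpha> < 1 \<longrightarrow>
       (\<exists>c C N\<^sub>0. c > 0 \<and> C > 0 \<and> N\<^sub>0 \<ge> 1 \<and> (\<forall>N\<ge>N\<^sub>0.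
          Linf_norm (cyl 1) (f\<^sub>N N) \<le> ennreal (C * N powr (- 2 / 3)) \<and>
          holder_semi \<alpha> (cyl 1) (s\<^sub>N N) = 0 \<and>
          holder_semi \<alpha> (cyl (1 / 2)) (hess_p (f\<^sub>N N)) \<ge> ennreal (c * N powr (\<alpha> / 3))))) \<and>
    (\<forall>\<alpha>. 0 < \<alpha> \<and> \<alpha> < 1 \<longrightarrow> \<not> (\<exists>C>0. linear_schauder A\<^sub>0 B\<^sub>0 \<alpha> C)) \<and>
    (\<forall>\<alpha> \<beta>. 0 < \<alpha> \<and> \<alpha> < 1 \<and> 0 < \<beta> \<and> \<beta> < 1 \<longrightarrow>
       \<not> (\<exists>F. bounded_on_bounded F \<and> general_schauder UNIV \<alpha> \<beta> F)) \<and>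
    (\<exists>l L. 0 < l \<and> l \<le> L \<and>
       (\<forall>\<alpha> \<beta>. 0 < \<alpha> \<and> \<alpha> < 1 \<and> 0 < \<beta> \<and> \<beta> < 1 \<longrightarrow>
          \<not> (\<exists>F. bounded_on_bounded F \<and> general_schauder (elliptic_class l L) \<alpha> \<beta> F)))"
proof (intro conjI allI impI)
  show "smooth_on UNIV A\<^sub>0" "smooth_on UNIV B\<^sub>0"
    by (intro smooth_imp_smooth_on smooth_A\<^sub>0 smooth_B\<^sub>0)+
next
  fix N :: real
  assume "1 \<le> N"
  then show "smooth_on UNIV (f\<^sub>N N)" "solves_on UNIV A\<^sub>0 B\<^sub>0 (f\<^sub>N N) (s\<^sub>N N)"
    by (auto intro!: smooth_imp_smooth_on smooth_f\<^sub>N f\<^sub>N_solves_on)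
next
  show "f\<^sub>N N (t, x, p) = f\<^sub>N N (t', x, p)" for N t t' x p
    by (simp add: f\<^sub>N_def)
next
  fix \<alpha> :: real
  assume "0 < \<alpha> \<and> \<alpha> < 1"
  then obtain c N\<^sub>0 where "c > 0" "N\<^sub>0 \<ge> 1"
    "\<And>N. N \<ge> N\<^sub>0 \<Longrightarrow> ennreal (c * N powr (\<alpha> / 3)) \<le> holder_semi \<alpha> (cyl (1 / 2)) (hess_p (f\<^sub>N N))"
    using holder_semi_hess_f\<^sub>N_ge by blast
  moreover obtain C where "C > 0" "\<And>N. N > 0 \<Longrightarrow> Linf_norm (cyl 1) (f\<^sub>N N) \<le> ennreal (C * N powr (- 2 / 3))"
    using Linf_norm_f\<^sub>N_le by blast
  ultimately show "\<exists>c C N\<^sub>0. c > 0 \<and> C > 0 \<and> N\<^sub>0 \<ge> 1 \<and> (\<forall>N\<ge>N\<^sub>0.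
          Linf_norm (cyl 1) (f\<^sub>N N) \<le> ennreal (C * N powr (- 2 / 3)) \<and>
          holder_semi \<alpha> (cyl 1) (s\<^sub>N N) = 0 \<and>
          holder_semi \<alpha> (cyl (1 / 2)) (hess_p (f\<^sub>N N)) \<ge> ennreal (c * N powr (\<alpha> / 3)))"
    by (intro exI[of _ c] exI[of _ C] exI[of _ N\<^sub>0]) (auto simp: holder_semi_s\<^sub>N)
next
  show "\<not> (\<exists>C>0. linear_schauder A\<^sub>0 B\<^sub>0 \<alpha> C)" if "0 < \<alpha> \<and> \<alpha> < 1" for \<alpha>
    using not_linear_schauder that by blast
next
  show "\<not> (\<exists>F. bounded_on_bounded F \<and> general_schauder UNIV \<alpha> \<beta> F)"
    if "0 < \<alpha> \<and> \<alpha> < 1 \<and> 0 < \<beta> \<and> \<beta> < 1" for \<alpha> \<beta>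
    using not_general_schauder[of \<alpha> \<beta> UNIV] that by blast
next
  have "(A\<^sub>0, B\<^sub>0) \<in> elliptic_class 1 8"
    by (auto simp: elliptic_class_def A\<^sub>0_symmetric A\<^sub>0_elliptic)
  then show "\<exists>l L. 0 < l \<and> l \<le> L \<and>
       (\<forall>\<alpha> \<beta>. 0 < \<alpha> \<and> \<alpha> < 1 \<and> 0 < \<beta> \<and> \<beta> < 1 \<longrightarrow>
          \<not> (\<exists>F. bounded_on_bounded F \<and> general_schauder (elliptic_class l L) \<alpha> \<beta> F))"
    using not_general_schauder by (intro exI[of _ 1] exI[of _ 8]) auto
qed

end
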